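(* Let $Z = m_1P_1 + \cdots + m_sP_s$ be a set of fat points in $\mathbb{P}^n \times \mathbb{P}^m$, with coordinates chosen so that neither $x_0$ nor $y_0$ vanishes at any point of $\operatorname{Supp}(Z)$, and suppose that $Z$ is arithmetically Cohen-Macaulay. Let $P_i \in \operatorname{Supp}(Z)$. If $\{F_1,\ldots,F_p\}$ is a set of minimal separators of the point $P_i$ of multiplicity $m_i$, then $\{F_1,\ldots,F_p\}$ is also a good set of minimal separators.
   Context: Let $k$ be an algebraically closed field of characteristic zero and $n,m$ positive integers. Let $R=k[x_0,\ldots,x_n,y_0,\ldots,y_m]$ be the $\mathbb{N}^2$-graded coordinate ring of $\mathbb{P}^n\times\mathbb{P}^m$, with $\deg x_i=(1,0)$ and $\deg y_i=(0,1)$. For a point $P\in\mathbb{P}^n\times\mathbb{P}^m$, $I_P\subseteq R$ is its bihomogeneous defining prime ideal (generated by $n$ forms of degree $(1,0)$ and $m$ forms of degree $(0,1)$). Fat points: for distinct points $P_1,\ldots,P_s$ and positive integers $m_1,\ldots,m_s$, the fat point scheme (set of fat points) $Z=m_1P_1+\cdots+m_sP_s$ is the scheme defined by $I_Z=I_{P_1}^{m_1}\cap\cdots\cap I_{P_s}^{m_s}$; $\operatorname{Supp}(Z)=\{P_1,\ldots,P_s\}$. $Z$ is arithmetically Cohen-Macaulay (ACM) if $\dim R/I_Z=2=\operatorname{depth} R/I_Z$. Given a point $P_i\in\operatorname{Supp}(Z)$, $Z'=m_1P_1+\cdots+(m_i-1)P_i+\cdots+m_sP_s$ is obtained by reducing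 the multiplicity of $P_i$ by one (if $m_i=1$ the point $P_i$ is dropped; the ideal of the empty scheme is $R$). A bar denotes the class in $R/I_Z$. Minimal separators: a finite set of bihomogeneous forms $\{F_1,\ldots,F_p\}\subseteq R$ is a set of minimal separators of $P_i$ of multiplicity $m_i$ if $I_{Z'}/I_Z=(\overline{F}_1,\ldots,\overline{F}_p)$ as an ideal of $R/I_Z$, and there is no set $\{G_1,\ldots,G_q\}$ with $q<p$ such that $I_{Z'}/I_Z=(\overline{G}_1,\ldots,\overline{G}_q)$. Good sets: coordinates are assumed chosen so that neither $x_0$ nor $y_0$ vanishes at any point of $\operatorname{Supp}(Z)$ (so both are nonzero-divisors on $R/I_Z$ and $R/I_{Z'}$). A set of minimal separators $\{F_1,\ldots,F_p\}$ of $P_i$ of multiplicity $m_i$, with $\deg F_l=(d_{l1},d_{l2})$, is a good set of minimal separators if for every $\underline{t}=(t_1,t_2)\in\mathbb{N}^2$ the elements $\overline{x_0^{t_1-d_{11}}y_0^{t_2-d_{12}}F_1},\ldots,\overline{x_0^{t_1-d_{p1}}y_0^{t_2-d_{p2}}F_p}$ (as an indexed family, omitting the $l$-th element whenever $t_1-d_{l1}<0$ or $t_2-d_{l2}<0$) are $k$-linearly independent in $(I_{Z'}/I_Z)_{\underline{t}}$. *)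

theory Defs
  imports
    "HOL-Library.Poly_Mapping"
    "HOL-Library.Extended_Nat"
    "HOL-Algebra.Algebra"
    "HOL-Algebra.Algebraic_Closure_Type"
begin

section \<open>The bigraded coordinate ring\<close>

text \<open>
  The integers \<open>n, m \<ge> 1\<close> are the cardinalities of the finite index types
  \<open>'n\<close> and \<open>'m\<close>. The variables \<open>x\<^sub>0, \<dots>, x\<^sub>n\<close> are indexed by \<open>'n option\<close>, with
  \<open>None\<close> as the index \<open>0\<close>, and likewise \<open>y\<^sub>0, \<dots>, y\<^sub>m\<close> by \<open>'m option\<close>.
\<close>

type_synonym ('n, 'm) bimonom = "('n option + 'm option) \<Rightarrow>\<^sub>0 nat"
type_synonym ('k, 'n, 'm) bipoly = "('n, 'm) bimonom \<Rightarrow>\<^sub>0 'k"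

abbreviation coord_ring :: "('k::field, 'n::finite, 'm::finite) bipoly ring" where
  "coord_ring \<equiv> ring_of_type_algebra"

definition const :: "'k::field \<Rightarrow> ('k, 'n::finite, 'm::finite) bipoly" where
  "const c = Poly_Mapping.single 0 c"

definition var_x :: "'n option \<Rightarrow> ('k::field, 'n::finite, 'm::finite) bipoly" where
  "var_x i = Poly_Mapping.single (Poly_Mapping.single (Inl i) 1) 1"

definition var_y :: "'m option \<Rightarrow> ('k::field, 'n::finite, 'm::finite) bipoly" where
  "var_y j = Poly_Mapping.single (Poly_Mapping.single (Inr j) 1) 1"

definition monom_bidegree :: "('n::finite, 'm::finite) bimonom \<Rightarrow> nat \<times> nat" where
  "monom_bidegree a =
     (\<Sum>i\<in>UNIV. Poly_Mapping.lookup a (Inl i), \<Sum>j\<in>UNIV. Poly_Mapping.lookup a (Inr j))"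

definition bihomogeneous :: "nat \<times> nat \<Rightarrow> ('k::field, 'n::finite, 'm::finite) bipoly \<Rightarrow> bool" where
  "bihomogeneous d f \<longleftrightarrow> (\<forall>a\<in>Poly_Mapping.keys f. monom_bidegree a = d)"

definition biform :: "('k::field, 'n::finite, 'm::finite) bipoly \<Rightarrow> bool" where
  "biform f \<longleftrightarrow> (\<exists>d. bihomogeneous d f)"

text \<open>Only meaningful for nonzero forms, whose bidegree is unique.\<close>
definition bidegree :: "('k::field, 'n::finite, 'm::finite) bipoly \<Rightarrow> nat \<times> nat" where
  "bidegree f = (THE d. bihomogeneous d f)"

definition bieval ::
  "('n option \<Rightarrow> 'k) \<Rightarrow> ('m option \<Rightarrow> 'k) \<Rightarrow> ('k::field, 'n::finite, 'm::finite) bipoly \<Rightarrow> 'k" where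
  "bieval u v f = (\<Sum>a\<in>Poly_Mapping.keys f. Poly_Mapping.lookup f a
      * (\<Prod>i\<in>UNIV. u i ^ Poly_Mapping.lookup a (Inl i))
      * (\<Prod>j\<in>UNIV. v j ^ Poly_Mapping.lookup a (Inr j)))"

section \<open>Krull dimension and depth\<close>

definition krull_dim :: "('a, 'b) ring_scheme \<Rightarrow> enat" where
  "krull_dim A = Sup {enat l | l. \<exists>p :: nat \<Rightarrow> 'a set.
      (\<forall>i\<le>l. primeideal (p i) A) \<and> (\<forall>i<l. p i \<subset> p (Suc i))}"

text \<open>
  Each \<open>xs ! i\<close> is a nonzerodivisor on \<open>A\<close> modulo the ideal of its predecessors,
  and the ideal generated by all of \<open>xs\<close> is proper.
\<close>
definition regular_sequence :: "('a, 'b) ring_scheme \<Rightarrow> 'a list \<Rightarrow> bool" where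
  "regular_sequence A xs \<longleftrightarrow>
     set xs \<subseteq> carrier A \<and>
     (\<forall>i<length xs. \<forall>a\<in>carrier A.
        (xs ! i) \<otimes>\<^bsub>A\<^esub> a \<in> genideal A (set (take i xs)) \<longrightarrow> a \<in> genideal A (set (take i xs))) \<and>
     genideal A (set xs) \<noteq> carrier A"

definition depth :: "('a, 'b) ring_scheme \<Rightarrow> 'a set \<Rightarrow> enat" where
  "depth A q = Sup {enat (length xs) | xs. set xs \<subseteq> q \<and> regular_sequence A xs}"

section \<open>Fat points\<close>

text \<open>A point of projective space is the set of all its homogeneous coordinate vectors.\<close>

definition proj_space :: "('i \<Rightarrow> 'k::field) set set" where
  "proj_space = {v. \<exists>i. v i \<noteq> 0} // {(u, v). \<exists>c. c \<noteq> 0 \<and> v = (\<lambda>i. c * u i)}"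

type_synonym ('k, 'n, 'm) bipoint = "('n option \<Rightarrow> 'k) set \<times> ('m option \<Rightarrow> 'k) set"

definition biproj_space :: "('k::field, 'n::finite, 'm::finite) bipoint set" where
  "biproj_space = proj_space \<times> proj_space"

definition vanishes_at ::
  "('k::field, 'n::finite, 'm::finite) bipoly \<Rightarrow> ('k, 'n, 'm) bipoint \<Rightarrow> bool" where
  "vanishes_at f P \<longleftrightarrow> (\<forall>u\<in>fst P. \<forall>v\<in>snd P. bieval u v f = 0)"

definition point_ideal ::
  "('k::field, 'n::finite, 'm::finite) bipoint \<Rightarrow> ('k, 'n, 'm) bipoly set" where
  "point_ideal P = genideal coord_ring {f. biform f \<and> vanishes_at f P}"

text \<open>
  The scheme \<open>m\<^sub>1P\<^sub>1 + \<dots> + m\<^sub>sP\<^sub>s\<close> is given by its multiplicity function, which is \<open>0\<close>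
  at all points other than the \<open>P\<^sub>i\<close>.
\<close>

definition supp :: "(('k, 'n, 'm) bipoint \<Rightarrow> nat) \<Rightarrow> ('k::field, 'n::finite, 'm::finite) bipoint set" where
  "supp Z = {P. Z P \<noteq> 0}"

definition fat_points :: "(('k::field, 'n::finite, 'm::finite) bipoint \<Rightarrow> nat) \<Rightarrow> bool" where
  "fat_points Z \<longleftrightarrow> finite (supp Z) \<and> supp Z \<subseteq> biproj_space"

text \<open>The ideal of the empty scheme is the whole ring, whose carrier is \<open>UNIV\<close>.\<close>
definition fat_ideal ::
  "(('k::field, 'n::finite, 'm::finite) bipoint \<Rightarrow> nat) \<Rightarrow> ('k, 'n, 'm) bipoly set" where
  "fat_ideal Z = (\<Inter>P\<in>supp Z. point_ideal P [^]\<^bsub>ideals_set coord_ring\<^esub> Z P)"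

definition fat_ring ::
  "(('k::field, 'n::finite, 'm::finite) bipoint \<Rightarrow> nat) \<Rightarrow> ('k, 'n, 'm) bipoly set ring" where
  "fat_ring Z = coord_ring Quot fat_ideal Z"

definition residue_class ::
  "(('k::field, 'n::finite, 'm::finite) bipoint \<Rightarrow> nat) \<Rightarrow>
     ('k, 'n, 'm) bipoly \<Rightarrow> ('k, 'n, 'm) bipoly set" where
  "residue_class Z f = fat_ideal Z +>\<^bsub>coord_ring\<^esub> f"

definition irrelevant_ideal :: "('k::field, 'n::finite, 'm::finite) bipoly set" where
  "irrelevant_ideal = genideal coord_ring (Set.range var_x \<union> Set.range var_y)"

text \<open>
  As usual, the depth is taken with respect to the maximal ideal generated by all variables,
  and the elements of a regular sequence need not be bihomogeneous.
\<close>
definition ACM :: "(('k::field, 'n::finite, 'm::finite) bipoint \<Rightarrow> nat) \<Rightarrow> bool" where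
  "ACM Z \<longleftrightarrow> krull_dim (fat_ring Z) = 2 \<and>
             depth (fat_ring Z) (residue_class Z ` irrelevant_ideal) = 2"

section \<open>Separators\<close>

definition reduce_at ::
  "(('k::field, 'n::finite, 'm::finite) bipoint \<Rightarrow> nat) \<Rightarrow> ('k, 'n, 'm) bipoint \<Rightarrow>
     (('k, 'n, 'm) bipoint \<Rightarrow> nat)" where
  "reduce_at Z P = Z(P := Z P - 1)"

text \<open>
  A set \<open>{F\<^sub>1, \<dots>, F\<^sub>p}\<close> is given as a list, because goodness below is a condition on an indexed
  family; minimality forces the entries to be distinct.
\<close>
definition minimal_separators ::
  "(('k::field, 'n::finite, 'm::finite) bipoint \<Rightarrow> nat) \<Rightarrow> ('k, 'n, 'm) bipoint \<Rightarrow>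
     ('k, 'n, 'm) bipoly list \<Rightarrow> bool" where
  "minimal_separators Z P F \<longleftrightarrow>
     (\<forall>f\<in>set F. biform f) \<and>
     residue_class Z ` fat_ideal (reduce_at Z P) = genideal (fat_ring Z) (residue_class Z ` set F) \<and>
     \<not> (\<exists>G. finite G \<and> card G < length F \<and>
          residue_class Z ` fat_ideal (reduce_at Z P) = genideal (fat_ring Z) (residue_class Z ` G))"

definition good_minimal_separators ::
  "(('k::field, 'n::finite, 'm::finite) bipoint \<Rightarrow> nat) \<Rightarrow> ('k, 'n, 'm) bipoint \<Rightarrow>
     ('k, 'n, 'm) bipoly list \<Rightarrow> bool" where
  "good_minimal_separators Z P F \<longleftrightarrow>
     minimal_separators Z P F \<and>
     (\<forall>t1 t2. ring.independent (fat_ring Z) (residue_class Z ` Set.range const)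
        [residue_class Z
           (var_x None ^ (t1 - fst (bidegree f)) * var_y None ^ (t2 - snd (bidegree f)) * f).
         f \<leftarrow> F, fst (bidegree f) \<le> t1 \<and> snd (bidegree f) \<le> t2])"

end

theory Submission
  imports Defs
begin

text \<open>
  Write \<open>I \<subseteq> J\<close> for the ideals of \<open>Z\<close> and of \<open>Z\<close> with the multiplicity of \<open>P\<close> reduced by one. A
  translation of the coordinates turns the ideal of a point off \<open>x\<^sub>0 y\<^sub>0 = 0\<close> into the ideal of the
  remaining variables, whose powers are monomial; hence \<open>x\<^sub>0\<close> is regular modulo \<open>I\<close> and modulo \<open>J\<close>.
  Every variable has a power in \<open>I + (x\<^sub>0)\<close> or in \<open>I + (y\<^sub>0)\<close>, and depth at least two says that
  \<open>I + (x\<^sub>0)\<close> has trivial socle; so \<open>y\<^sub>0\<close> is regular modulo \<open>I + (x\<^sub>0)\<close>. It follows that \<open>x\<^sub>0, y\<^sub>0\<close>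
  is a regular sequence on \<open>J / I\<close>, and a linear relation among the multiples of the \<open>F\<^sub>l\<close> then
  reduces to one that expresses some \<open>F\<^sub>l\<close> by the others and \<open>x\<^sub>0 F\<^sub>l\<close> modulo \<open>I\<close>. As all ideals are
  bigraded, \<open>F\<^sub>l\<close> is superfluous, which contradicts minimality.
\<close>

section \<open>Ideals of a commutative ring type\<close>

lemma carrier_type_algebra [simp]: "carrier (ring_of_type_algebra :: 'a::comm_ring_1 ring) = UNIV"
  and mult_type_algebra [simp]: "f \<otimes>\<^bsub>ring_of_type_algebra\<^esub> g = f * (g :: 'a)"
  and add_type_algebra [simp]: "f \<oplus>\<^bsub>ring_of_type_algebra\<^esub> g = f + (g :: 'a)"
  and zero_type_algebra [simp]: "\<zero>\<^bsub>ring_of_type_algebra\<^esub> = (0 :: 'a)"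
  by (simp_all add: ring_of_type_algebra_def)

interpretation type_algebra: cring "ring_of_type_algebra :: 'a::comm_ring_1 ring"
  by (rule cring_from_type_algebra)

lemma a_inv_type_algebra [simp]: "\<ominus>\<^bsub>ring_of_type_algebra\<^esub> f = - (f :: 'a::comm_ring_1)"
  using type_algebra.minus_equality[of "- f" f] by simp

text \<open>Multiplication by \<open>-1\<close> supplies the additive inverses, so three closure
  conditions suffice; later sets are shown to be ideals through this criterion.\<close>

lemma ideal_type_algebra_iff:
  "ideal I (ring_of_type_algebra :: 'a::comm_ring_1 ring) \<longleftrightarrow>
     0 \<in> I \<and> (\<forall>f\<in>I. \<forall>g\<in>I. f + g \<in> I) \<and> (\<forall>f\<in>I. \<forall>r. r * f \<in> I)" (is "?L = ?R")
proof
  assume ?L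
  then interpret ideal I "ring_of_type_algebra :: 'a ring" .
  show ?R using zero_closed a_closed I_l_closed by simp
next
  assume R: ?R
  have neg: "- f \<in> I" if "f \<in> I" for f
    using R that by (metis mult_minus1)
  have "subgroup I (add_monoid (ring_of_type_algebra :: 'a ring))"
  proof (rule type_algebra.add.subgroupI)
    show "I \<subseteq> carrier ring_of_type_algebra" by simp
    show "I \<noteq> {}" using R by auto
    show "\<ominus>\<^bsub>ring_of_type_algebra\<^esub> f \<in> I" if "f \<in> I" for f using neg that by simp
    show "f \<oplus>\<^bsub>ring_of_type_algebra\<^esub> g \<in> I" if "f \<in> I" "g \<in> I" for f g using R that by simp
  qed
  then show ?L
    by (rule idealI[OF type_algebra.ring_axioms]) (use R in \<open>auto simp: mult.commute\<close>)
qed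

context
  fixes I :: "'a::comm_ring_1 set"
  assumes I: "ideal I ring_of_type_algebra"
begin

lemma ideal_0: "0 \<in> I"
  and ideal_add: "f \<in> I \<Longrightarrow> g \<in> I \<Longrightarrow> f + g \<in> I"
  and ideal_mult: "f \<in> I \<Longrightarrow> r * f \<in> I"
  using I by (auto simp: ideal_type_algebra_iff)

lemma ideal_mult_right: "f \<in> I \<Longrightarrow> f * r \<in> I"
  using ideal_mult by (simp add: mult.commute)

lemma ideal_uminus: "f \<in> I \<Longrightarrow> - f \<in> I"
  using ideal_mult[of f "-1"] by simp

lemma ideal_diff: "f \<in> I \<Longrightarrow> g \<in> I \<Longrightarrow> f - g \<in> I"
  using ideal_add[of f "- g"] ideal_uminus by simp

lemma ideal_sum: "(\<And>i. i \<in> A \<Longrightarrow> f i \<in> I) \<Longrightarrow> sum f A \<in> I"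
  by (induction A rule: infinite_finite_induct) (auto intro: ideal_0 ideal_add)

end

section \<open>Generated ideals and their passage to a quotient\<close>

abbreviation gen :: "'a::comm_ring_1 set \<Rightarrow> 'a set" where
  "gen S \<equiv> genideal (ring_of_type_algebra :: 'a ring) S"

lemma ideal_gen: "ideal (gen S) (ring_of_type_algebra :: 'a::comm_ring_1 ring)"
  by (simp add: type_algebra.genideal_ideal)

lemma subset_gen: "S \<subseteq> gen (S :: 'a::comm_ring_1 set)"
  by (simp add: type_algebra.genideal_self)

lemma gen_minimal:
  "ideal I (ring_of_type_algebra :: 'a::comm_ring_1 ring) \<Longrightarrow> S \<subseteq> I \<Longrightarrow> gen S \<subseteq> I"
  by (rule type_algebra.genideal_minimal)

lemma gen_mono: "S \<subseteq> T \<Longrightarrow> gen S \<subseteq> gen (T :: 'a::comm_ring_1 set)"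
  using subset_gen[of T] by (intro gen_minimal ideal_gen) auto

lemma gen_ideal: "ideal I (ring_of_type_algebra :: 'a::comm_ring_1 ring) \<Longrightarrow> gen I = I"
  by (intro subset_antisym subset_gen gen_minimal order_refl)

text \<open>The elements congruent to a multiple of \<open>x\<close> modulo \<open>gen S\<close>
  form an ideal containing \<open>x\<close> and \<open>S\<close>. Membership in
  \<open>I + (x)\<close> thereby becomes an explicit congruence modulo \<open>I\<close>.\<close>

lemma gen_insert_iff:
  "f \<in> gen (insert x S) \<longleftrightarrow> (\<exists>r. f - x * r \<in> gen (S :: 'a::comm_ring_1 set))"
proof
  let ?T = "{f. \<exists>r. f - x * r \<in> gen S}"
  have T: "f \<in> ?T" if "f - x * r \<in> gen S" for f r
    using that by blast
  have "ideal ?T ring_of_type_algebra"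
    unfolding ideal_type_algebra_iff
  proof (intro conjI ballI allI)
    show "0 \<in> ?T" using ideal_0[OF ideal_gen, of S] by (intro T[of _ 0]) simp
  next
    fix f g assume "f \<in> ?T" "g \<in> ?T"
    then obtain r s where "f - x * r \<in> gen S" "g - x * s \<in> gen S" by blast
    from ideal_add[OF ideal_gen this] show "f + g \<in> ?T"
      by (intro T[of _ "r + s"]) (simp add: algebra_simps)
  next
    fix f r assume "f \<in> ?T"
    then obtain s where "f - x * s \<in> gen S" by blast
    from ideal_mult[OF ideal_gen this, of r] show "r * f \<in> ?T"
      by (intro T[of _ "r * s"]) (simp add: algebra_simps)
  qed
  moreover have "insert x S \<subseteq> ?T"
  proof
    fix f assume "f \<in> insert x S"
    then consider "f = x" | "f \<in> gen S" using subset_gen[of S] by auto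
    then show "f \<in> ?T"
      using ideal_0[OF ideal_gen, of S] T[of x 1] T[of f 0] by cases simp_all
  qed
  ultimately have "gen (insert x S) \<subseteq> ?T" by (rule gen_minimal)
  then show "f \<in> gen (insert x S) \<Longrightarrow> \<exists>r. f - x * r \<in> gen S" by blast
next
  assume "\<exists>r. f - x * r \<in> gen S"
  then obtain r where "f - x * r \<in> gen S" ..
  then have "f - x * r \<in> gen (insert x S)" using gen_mono[of S "insert x S"] by blast
  moreover have "x * r \<in> gen (insert x S)"
    using subset_gen[of "insert x S"] by (intro ideal_mult_right[OF ideal_gen]) blast
  ultimately have "f - x * r + x * r \<in> gen (insert x S)" by (rule ideal_add[OF ideal_gen])
  then show "f \<in> gen (insert x S)" by simp
qed

text \<open>From right to left, the preimage of the ideal generated by the classes is an ideal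
  containing \<open>I\<close> and \<open>S\<close>. From left to right, the image of
  \<open>genideal R (I \<union> S)\<close> is an ideal containing the classes, and two elements with
  the same class differ by an element of \<open>I\<close>.\<close>

lemma (in ring) mem_genideal_quotient_iff:
  assumes "ideal I R" "S \<subseteq> carrier R" "f \<in> carrier R"
  shows "I +> f \<in> genideal (R Quot I) ((+>) I ` S) \<longleftrightarrow> f \<in> genideal R (I \<union> S)"
proof -
  have hom: "ring_hom_ring R (R Quot I) ((+>) I)"
    using assms(1) by (rule ideal.rcos_ring_hom_ring)
  have quot: "ring (R Quot I)"
    using assms(1) by (rule ideal.quotient_is_ring)
  have IS: "I \<union> S \<subseteq> carrier R" using assms(2) ideal.Icarr[OF assms(1)] by blast
  have img: "(+>) I ` S \<subseteq> carrier (R Quot I)"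
    by (intro image_subsetI ring_hom_closed[OF ideal.rcos_ring_hom[OF assms(1)]])
      (use assms(2) in blast)
  let ?G = "genideal (R Quot I) ((+>) I ` S)" and ?H = "genideal R (I \<union> S)"
  have G: "ideal ?G (R Quot I)" by (rule ring.genideal_ideal[OF quot img])
  have H: "ideal ?H R" by (rule genideal_ideal[OF IS])
  have "ideal {r \<in> carrier R. I +> r \<in> ?G} R"
    by (rule ring_hom_ring.ideal_vimage[OF hom G])
  moreover have "I \<union> S \<subseteq> {r \<in> carrier R. I +> r \<in> ?G}"
  proof
    fix r assume r: "r \<in> I \<union> S"
    have "I +> r \<in> ?G"
    proof (cases "r \<in> S")
      case True
      then show ?thesis using ring.genideal_self[OF quot img] by blast
    next
      case False
      then have "I +> r = \<zero>\<^bsub>R Quot I\<^esub>"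
        using r abelian_subgroup.a_rcos_const[OF abelian_subgroupI3[OF ideal.axioms(1)[OF assms(1)] abelian_group_axioms]]
        by (simp add: FactRing_def)
      then show ?thesis
        using additive_subgroup.zero_closed[OF ideal.axioms(1)[OF G]] by simp
    qed
    with r IS show "r \<in> {r \<in> carrier R. I +> r \<in> ?G}" by blast
  qed
  ultimately have "?H \<subseteq> {r \<in> carrier R. I +> r \<in> ?G}" by (rule genideal_minimal)
  then have "f \<in> ?H \<Longrightarrow> I +> f \<in> ?G" by blast
  moreover have "f \<in> ?H" if "I +> f \<in> ?G"
  proof -
    have IH: "I \<subseteq> ?H" using genideal_self[OF IS] by (rule order_trans[rotated]) blast
    have "ideal ((+>) I ` ?H) (R Quot I)"
      using ring_ideal_imp_quot_ideal[OF assms(1) H] .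
    moreover have "(+>) I ` S \<subseteq> (+>) I ` ?H"
      using genideal_self[OF IS] by (intro image_mono) blast
    ultimately have "?G \<subseteq> (+>) I ` ?H" by (rule ring.genideal_minimal[OF quot])
    with that have "I +> f \<in> (+>) I ` ?H" ..
    then obtain g where g: "g \<in> ?H" "I +> f = I +> g" by auto
    then have "f \<ominus> g \<in> I"
      using quotient_eq_iff_same_a_r_cos[OF assms(1,3)] ideal.Icarr[OF H g(1)] by simp
    then have "(f \<ominus> g) \<oplus> g \<in> ?H"
      using IH g(1) by (intro additive_subgroup.a_closed[OF ideal.axioms(1)[OF H]]) blast+
    moreover have "(f \<ominus> g) \<oplus> g = f"
      using assms(3) ideal.Icarr[OF H g(1)] by (simp add: a_minus_def a_assoc l_neg)
    ultimately show ?thesis by simp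
  qed
  ultimately show ?thesis by blast
qed

section \<open>Depth and parameters\<close>

text \<open>
  If \<open>a w = x c\<close> and \<open>b w = x d\<close> modulo \<open>I\<close>, then \<open>b c = a d\<close> modulo \<open>I\<close> because \<open>x\<close> is regular; hence
  \<open>a\<close> divides \<open>c\<close> and \<open>x\<close> divides \<open>w\<close> modulo \<open>I\<close>.
\<close>
lemma socle_trivial:
  fixes I :: "'a::comm_ring_1 set"
  assumes I: "ideal I ring_of_type_algebra"
    and x: "\<And>f. x * f \<in> I \<Longrightarrow> f \<in> I"
    and a: "\<And>f. a * f \<in> I \<Longrightarrow> f \<in> I"
    and b: "\<And>f. b * f \<in> gen (insert a I) \<Longrightarrow> f \<in> gen (insert a I)"
    and w: "a * w \<in> gen (insert x I)" "b * w \<in> gen (insert x I)"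
  shows "w \<in> gen (insert x I)"
proof -
  note [simp] = gen_ideal[OF I]
  obtain c d where c: "a * w - x * c \<in> I" and d: "b * w - x * d \<in> I"
    using w by (auto simp: gen_insert_iff)
  have "a * (b * w - x * d) - b * (a * w - x * c) \<in> I"
    by (intro ideal_diff[OF I] ideal_mult[OF I] c d)
  then have "x * (b * c - a * d) \<in> I" by (simp add: algebra_simps)
  then have "b * c \<in> gen (insert a I)" using x by (auto simp: gen_insert_iff)
  then obtain e where "c - a * e \<in> I" using b by (auto simp: gen_insert_iff)
  then have "(a * w - x * c) + x * (c - a * e) \<in> I"
    by (intro ideal_add[OF I] ideal_mult[OF I] c)
  then have "a * (w - x * e) \<in> I" by (simp add: algebra_simps)
  then show ?thesis using a by (auto simp: gen_insert_iff)
qed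

text \<open>The elements of \<open>V\<close> are treated one at a time: multiplying by the last
  power of \<open>v\<close> that stays outside \<open>K\<close> lets \<open>v\<close> take the
  element into \<open>K\<close> and preserves this property for the elements treated before.\<close>

lemma exists_socle_multiple:
  fixes K :: "'a::comm_ring_1 set"
  assumes K: "ideal K ring_of_type_algebra" and "finite V" "z \<notin> K"
    and "\<And>v. v \<in> V \<Longrightarrow> \<exists>N. v ^ N * z \<in> K"
  shows "\<exists>r. r * z \<notin> K \<and> (\<forall>v\<in>V. v * (r * z) \<in> K)"
  using assms(2,4)
proof (induction V rule: finite_induct)
  case empty
  then show ?case using \<open>z \<notin> K\<close> by (auto intro: exI[of _ 1])
next
  case (insert v V)
  then obtain r where r: "r * z \<notin> K" "\<forall>u\<in>V. u * (r * z) \<in> K" by blast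
  obtain N where "v ^ N * z \<in> K" using insert.prems by blast
  then have "v ^ N * (r * z) \<in> K" using ideal_mult[OF K, of "v ^ N * z" r] by (simp add: ac_simps)
  \<comment> \<open>The exponent \<open>M\<close> is positive because \<open>r * z\<close> lies
    outside \<open>K\<close>; its predecessor \<open>L\<close> gives the last power of
    \<open>v\<close> that stays outside.\<close>
  moreover define M where "M = (LEAST N. v ^ N * (r * z) \<in> K)"
  ultimately have M: "v ^ M * (r * z) \<in> K" by (metis LeastI)
  with r(1) obtain L where L: "M = Suc L" by (cases M) auto
  then have "v ^ L * (r * z) \<notin> K" unfolding M_def using not_less_Least by (metis lessI)
  moreover have "v * (v ^ L * (r * z)) \<in> K" using M L by (simp add: ac_simps)
  moreover have "u * (v ^ L * (r * z)) \<in> K" if "u \<in> V" for u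
    using ideal_mult[OF K bspec[OF r(2) that], of "v ^ L"] by (simp add: ac_simps)
  ultimately show ?case by (intro exI[of _ "v ^ L * r"]) (auto simp: ac_simps)
qed

text \<open>If \<open>z\<close> were a counterexample, every \<open>v\<close> would have a power
  killing \<open>z\<close> modulo \<open>I + (x)\<close>, so some multiple of \<open>z\<close> would
  be a nonzero socle element, contrary to \<open>socle_trivial\<close>.\<close>

lemma parameter_regular:
  fixes I :: "'a::comm_ring_1 set"
  assumes I: "ideal I ring_of_type_algebra"
    and x: "\<And>f. x * f \<in> I \<Longrightarrow> f \<in> I"
    and V: "finite V" "a \<in> gen V" "b \<in> gen V"
    and a: "\<And>f. a * f \<in> I \<Longrightarrow> f \<in> I"
    and b: "\<And>f. b * f \<in> gen (insert a I) \<Longrightarrow> f \<in> gen (insert a I)"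
    and nilp: "\<And>v. v \<in> V \<Longrightarrow> \<exists>N. v ^ N \<in> gen (insert y (insert x I))"
    and z: "y * z \<in> gen (insert x I)"
  shows "z \<in> gen (insert x I)"
proof (rule ccontr)
  let ?K = "gen (insert x I)"
  have K: "ideal ?K ring_of_type_algebra" by (rule ideal_gen)
  assume "z \<notin> ?K"
  moreover have "\<exists>N. v ^ N * z \<in> ?K" if v: "v \<in> V" for v
  proof -
    obtain N where "v ^ N \<in> gen (insert y (insert x I))" using nilp[OF v] ..
    then obtain r where "v ^ N - y * r \<in> ?K" using gen_insert_iff[of _ y] by blast
    \<comment> \<open>Modulo \<open>I + (x)\<close>, \<open>v ^ N\<close> is \<open>y * r\<close>
      and \<open>y * z\<close> vanishes, so \<open>v ^ N * z\<close> vanishes too.\<close>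
    from ideal_add[OF K ideal_mult[OF K this, of z] ideal_mult[OF K z, of r]]
    show ?thesis by (auto simp: algebra_simps)
  qed
  ultimately obtain r where r: "r * z \<notin> ?K" "\<forall>v\<in>V. v * (r * z) \<in> ?K"
    using exists_socle_multiple[OF K V(1)] by blast
  \<comment> \<open>The annihilator of \<open>r * z\<close> modulo \<open>I + (x)\<close> is an
    ideal containing \<open>V\<close>, hence it contains \<open>a\<close> and
    \<open>b\<close>.\<close>
  have "ideal {f. f * (r * z) \<in> ?K} ring_of_type_algebra"
    unfolding ideal_type_algebra_iff
    using ideal_0[OF K] ideal_add[OF K] ideal_mult[OF K] by (auto simp: distrib_right mult.assoc)
  then have "gen V \<subseteq> {f. f * (r * z) \<in> ?K}" by (rule gen_minimal) (use r in auto)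
  then have "a * (r * z) \<in> ?K" "b * (r * z) \<in> ?K" using V by auto
  then have "r * z \<in> ?K" using socle_trivial[OF I x a b] by blast
  then show False using r by blast
qed

section \<open>Bigraded ideals\<close>

text \<open>The summands may share keys, so every additive property reduces to single terms.\<close>

lemma poly_mapping_single_induct [case_names single add]:
  assumes "\<And>a c. Q (Poly_Mapping.single a c)" "\<And>f g. Q f \<Longrightarrow> Q g \<Longrightarrow> Q (f + g)"
  shows "Q (f :: 'a \<Rightarrow>\<^sub>0 'b::monoid_add)"
proof (induction f rule: Poly_Mapping.update_induct)
  case const
  show ?case using assms(1)[of undefined 0] by simp
next
  case (update f a b)
  then have "Poly_Mapping.update a b f = Poly_Mapping.single a b + f"
    by (intro poly_mapping_eqI)
      (auto simp: lookup_update lookup_add lookup_single when_def in_keys_iff)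
  then show ?case using assms update by simp
qed

text \<open>By cancellation \<open>a + b\<close> determines \<open>b\<close>, so multiplication by a
  single term only shifts and scales coefficients.\<close>

lemma lookup_single_mult:
  fixes f :: "'a::cancel_comm_monoid_add \<Rightarrow>\<^sub>0 'b::comm_semiring_1"
  shows "Poly_Mapping.lookup (Poly_Mapping.single a c * f) (a + b) = c * Poly_Mapping.lookup f b"
  by (induction f rule: poly_mapping_single_induct)
    (auto simp: mult_single lookup_single when_def distrib_left lookup_add)

lemma lookup_const_mult:
  "Poly_Mapping.lookup (const c * f) a = c * Poly_Mapping.lookup f a"
  using lookup_single_mult[of 0 c f a] by (simp add: const_def)

lemma keys_single_mult:
  fixes f :: "'a::cancel_comm_monoid_add \<Rightarrow>\<^sub>0 'b::comm_semiring_1"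
  assumes "b \<in> Poly_Mapping.keys f"
  shows "a + b \<in> Poly_Mapping.keys (Poly_Mapping.single a 1 * f)"
  using assms lookup_single_mult[of a 1 f b] by (simp add: in_keys_iff)

lemma const_0 [simp]: "const 0 = 0" and const_1 [simp]: "const 1 = 1"
  and const_add: "const (a + b) = const a + const b"
  and const_uminus: "const (- a) = - const a"
  and const_mult: "const (a * b) = const a * const b"
  by (simp_all add: const_def single_add single_uminus mult_single)

lemma const_sum: "const (sum c A) = (\<Sum>i\<in>A. const (c i))"
  by (induction A rule: infinite_finite_induct) (simp_all add: const_add)

lemma const_prod: "const (prod c A) = (\<Prod>i\<in>A. const (c i))"
  by (induction A rule: infinite_finite_induct) (simp_all add: const_mult)

lemma const_power: "const (a ^ n) = const a ^ n"
  by (induction n) (simp_all add: const_mult)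

lemma monom_bidegree_add:
  "monom_bidegree (a + b) =
     (fst (monom_bidegree a) + fst (monom_bidegree b), snd (monom_bidegree a) + snd (monom_bidegree b))"
  by (simp add: monom_bidegree_def lookup_add sum.distrib)

lemma bihomogeneous_mult:
  assumes "bihomogeneous (d1, d2) f" "bihomogeneous (e1, e2) g"
  shows "bihomogeneous (d1 + e1, d2 + e2) (f * g)"
  using assms keys_mult[of f g] by (fastforce simp: bihomogeneous_def monom_bidegree_add)

lemma bihomogeneous_diff:
  assumes "bihomogeneous d f" "bihomogeneous d g"
  shows "bihomogeneous d (f - g)"
  using assms by (auto simp: bihomogeneous_def in_keys_iff lookup_minus)

lemma bihomogeneous_single: "bihomogeneous (monom_bidegree a) (Poly_Mapping.single a c)"
  by (simp add: bihomogeneous_def)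

lemma bihomogeneous_var_x: "bihomogeneous (1, 0) (var_x i)"
  and bihomogeneous_var_y: "bihomogeneous (0, 1) (var_y j)"
  by (simp_all add: bihomogeneous_def var_x_def var_y_def monom_bidegree_def lookup_single when_def
      flip: One_nat_def)

lemma bihomogeneous_const: "bihomogeneous (0, 0) (const c)"
  by (simp add: bihomogeneous_def const_def monom_bidegree_def)

lemma bihomogeneous_unique:
  assumes "bihomogeneous d f" "bihomogeneous e f" "f \<noteq> 0"
  shows "d = e"
  using assms by (metis bihomogeneous_def ex_in_conv keys_eq_empty)

lemma bihomogeneous_bidegree:
  assumes "biform f" "f \<noteq> 0"
  shows "bihomogeneous (bidegree f) f"
  using assms bihomogeneous_unique unfolding biform_def bidegree_def by (metis theI)

text \<open>The bihomogeneous component of \<open>f\<close> of bidegree \<open>d\<close>;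
  \<open>lookup_bicomp\<close> checks the finite support that \<open>Abs_poly_mapping\<close>
  requires.\<close>

definition bicomp :: "nat \<times> nat \<Rightarrow> ('k::field, 'n::finite, 'm::finite) bipoly \<Rightarrow> ('k, 'n, 'm) bipoly"
  where "bicomp d f = Abs_poly_mapping (\<lambda>a. Poly_Mapping.lookup f a when monom_bidegree a = d)"

lemma lookup_bicomp:
  "Poly_Mapping.lookup (bicomp d f) a = (Poly_Mapping.lookup f a when monom_bidegree a = d)"
proof -
  have "finite {a. (Poly_Mapping.lookup f a when monom_bidegree a = d) \<noteq> 0}"
    by (rule finite_subset[of _ "Poly_Mapping.keys f"]) (auto simp: in_keys_iff)
  then show ?thesis by (simp add: bicomp_def)
qed

lemma bicomp_0 [simp]: "bicomp d 0 = 0"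
  and bicomp_add: "bicomp d (f + g) = bicomp d f + bicomp d g"
  and bicomp_diff: "bicomp d (f - g) = bicomp d f - bicomp d g"
  by (rule poly_mapping_eqI,
      simp add: lookup_bicomp lookup_add lookup_minus when_add_distrib when_diff_distrib)+

lemma bicomp_sum: "bicomp d (sum f A) = (\<Sum>i\<in>A. bicomp d (f i))"
  by (induction A rule: infinite_finite_induct) (simp_all add: bicomp_add)

lemma bicomp_bihomogeneous: "bihomogeneous e f \<Longrightarrow> bicomp d f = (if d = e then f else 0)"
  by (auto intro!: poly_mapping_eqI simp: lookup_bicomp bihomogeneous_def when_def in_keys_iff)

lemma bihomogeneous_bicomp: "bihomogeneous d (bicomp d f)"
  by (auto simp: bihomogeneous_def in_keys_iff lookup_bicomp when_def split: if_splits)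

lemma sum_bicomp: "(\<Sum>d\<in>monom_bidegree ` Poly_Mapping.keys f. bicomp d f) = f"
proof (rule poly_mapping_eqI)
  fix a
  show "Poly_Mapping.lookup (\<Sum>d\<in>monom_bidegree ` Poly_Mapping.keys f. bicomp d f) a =
    Poly_Mapping.lookup f a"
    by (cases "a \<in> Poly_Mapping.keys f") (auto simp: lookup_sum lookup_bicomp when_def in_keys_iff)
qed

text \<open>A form shifts bidegrees by its own. The case distinction guards the truncated
  subtraction on \<open>nat\<close>.\<close>

lemma bicomp_mult:
  assumes "bihomogeneous (e1, e2) g"
  shows "bicomp (d1, d2) (g * f) =
    (if e1 \<le> d1 \<and> e2 \<le> d2 then g * bicomp (d1 - e1, d2 - e2) f else 0)"
proof (induction f rule: poly_mapping_single_induct)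
  case (single b c)
  obtain b1 b2 where b: "monom_bidegree b = (b1, b2)" by fastforce
  have h: "bihomogeneous (b1, b2) (Poly_Mapping.single b c)"
    using bihomogeneous_single[of b c] b by simp
  show ?case
    by (auto simp: bicomp_bihomogeneous[OF h] bicomp_bihomogeneous[OF bihomogeneous_mult[OF assms h]])
qed (auto simp: bicomp_add distrib_left)

definition bigraded :: "('k::field, 'n::finite, 'm::finite) bipoly set \<Rightarrow> bool" where
  "bigraded K \<longleftrightarrow> (\<forall>f\<in>K. \<forall>d. bicomp d f \<in> K)"

text \<open>By additivity \<open>r\<close> may be taken to be a single term, which only shifts the
  components of \<open>f\<close>.\<close>

lemma bigraded_mult:
  assumes "ideal K coord_ring" "\<And>d. bicomp d f \<in> K"
  shows "bicomp d (r * f) \<in> K"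
proof (induction r rule: poly_mapping_single_induct)
  case (single a c)
  obtain a1 a2 where a: "monom_bidegree a = (a1, a2)" by fastforce
  have h: "bihomogeneous (a1, a2) (Poly_Mapping.single a c)"
    using bihomogeneous_single[of a c] a by simp
  obtain d1 d2 where d: "d = (d1, d2)" by fastforce
  show ?case unfolding d bicomp_mult[OF h]
    using ideal_0[OF assms(1)] ideal_mult[OF assms(1) assms(2)] by simp
qed (use assms in \<open>auto simp: bicomp_add distrib_right intro: ideal_add\<close>)

text \<open>The elements all of whose components lie in \<open>gen S\<close> form an ideal, by
  \<open>bigraded_mult\<close>.\<close>

lemma bigraded_gen:
  assumes "\<And>f d. f \<in> S \<Longrightarrow> bicomp d f \<in> gen S"
  shows "bigraded (gen S)"
proof -
  have "ideal {f. \<forall>d. bicomp d f \<in> gen S} coord_ring"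
    unfolding ideal_type_algebra_iff
  proof (intro conjI ballI allI)
    show "0 \<in> {f. \<forall>d. bicomp d f \<in> gen S}" using ideal_0[OF ideal_gen, of S] by simp
  next
    fix f g assume "f \<in> {f. \<forall>d. bicomp d f \<in> gen S}" "g \<in> {f. \<forall>d. bicomp d f \<in> gen S}"
    then show "f + g \<in> {f. \<forall>d. bicomp d f \<in> gen S}"
      by (auto simp: bicomp_add intro: ideal_add[OF ideal_gen])
  next
    fix f r assume "f \<in> {f. \<forall>d. bicomp d f \<in> gen S}"
    then show "r * f \<in> {f. \<forall>d. bicomp d f \<in> gen S}"
      by (auto intro: bigraded_mult[OF ideal_gen])
  qed
  then have "gen S \<subseteq> {f. \<forall>d. bicomp d f \<in> gen S}"
    by (rule gen_minimal) (use assms in auto)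
  then show ?thesis by (auto simp: bigraded_def)
qed

lemma bigraded_gen_Un:
  assumes "bigraded K" "\<And>f. f \<in> S \<Longrightarrow> biform f"
  shows "bigraded (gen (K \<union> S))"
proof (rule bigraded_gen)
  fix f d assume "f \<in> K \<union> S"
  then consider "f \<in> K" | e where "f \<in> S" "bihomogeneous e f"
    using assms(2) unfolding biform_def by blast
  then have "bicomp d f \<in> insert 0 (K \<union> S)"
    using assms(1) by cases (simp_all add: bigraded_def bicomp_bihomogeneous del: split_paired_All)
  then show "bicomp d f \<in> gen (K \<union> S)"
    using subset_gen[of "K \<union> S"] ideal_0[OF ideal_gen, of "K \<union> S"] by auto
qed

lemma bigraded_gen_biforms: "(\<And>f. f \<in> S \<Longrightarrow> biform f) \<Longrightarrow> bigraded (gen S)"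
  using bigraded_gen_Un[of "{}" S] by (simp add: bigraded_def)

lemma bigraded_Inter: "(\<And>K. K \<in> A \<Longrightarrow> bigraded K) \<Longrightarrow> bigraded (\<Inter>A)"
  by (auto simp: bigraded_def)

text \<open>Once \<open>i\<close> is split into its components, each component of
  \<open>i * j\<close> is a sum of products of components of \<open>i\<close> and of
  \<open>j\<close>.\<close>

lemma bigraded_ideal_prod:
  assumes "ideal I coord_ring" "ideal J coord_ring" "bigraded I" "bigraded J"
  shows "bigraded (ideal_prod coord_ring I J)"
  unfolding bigraded_def
proof (intro ballI allI)
  let ?IJ = "ideal_prod coord_ring I J"
  have IJ: "ideal ?IJ coord_ring"
    using assms(1,2) by (rule type_algebra.ideal_prod_is_ideal)
  fix f d assume "f \<in> ?IJ"
  then show "bicomp d f \<in> ?IJ"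
  proof (induction f rule: ideal_prod.induct)
    case (prod i j)
    obtain d1 d2 where d: "d = (d1, d2)" by fastforce
    have mem: "bicomp d (bicomp (e1, e2) i * j) \<in> ?IJ" for e1 e2
      unfolding d bicomp_mult[OF bihomogeneous_bicomp]
      using ideal_0[OF IJ] ideal_prod.prod[of "bicomp (e1, e2) i" I _ J coord_ring] prod assms(3,4)
      by (auto simp: bigraded_def)
    have "i * j = (\<Sum>e\<in>monom_bidegree ` Poly_Mapping.keys i. bicomp e i * j)"
      by (simp add: sum_bicomp flip: sum_distrib_right)
    then have "bicomp d (i * j) = (\<Sum>e\<in>monom_bidegree ` Poly_Mapping.keys i. bicomp d (bicomp e i * j))"
      by (metis bicomp_sum)
    also have "\<dots> \<in> ?IJ"
      by (rule ideal_sum[OF IJ]) (use mem in auto)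
    finally show ?case by simp
  next
    case (sum f g)
    then show ?case using ideal_add[OF IJ] by (simp add: bicomp_add)
  qed
qed

section \<open>Powers of ideals and substitutions\<close>

abbreviation ideal_pow :: "'a::comm_ring_1 set \<Rightarrow> nat \<Rightarrow> 'a set" where
  "ideal_pow I n \<equiv> I [^]\<^bsub>ideals_set (ring_of_type_algebra :: 'a ring)\<^esub> n"

lemma mult_ideals_set [simp]: "I \<otimes>\<^bsub>ideals_set R\<^esub> J = ideal_prod R I J"
  and one_ideals_set [simp]: "\<one>\<^bsub>ideals_set R\<^esub> = carrier R"
  by (simp_all add: ideals_set_def)

lemma monoid_ideals_set: "Group.monoid (ideals_set (ring_of_type_algebra :: 'a::comm_ring_1 ring))"
  using type_algebra.ideals_set_is_comm_monoid by (rule comm_monoid.axioms(1))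

context
  fixes I :: "'a::comm_ring_1 set"
  assumes I: "ideal I ring_of_type_algebra"
begin

lemma ideal_ideal_pow: "ideal (ideal_pow I n) ring_of_type_algebra"
  using monoid.nat_pow_closed[OF monoid_ideals_set, of I n] I by (simp add: ideals_set_def)

lemma ideal_pow_Suc_subset: "ideal_pow I (Suc n) \<subseteq> ideal_pow I n"
  using type_algebra.ideal_prod_inter[OF ideal_ideal_pow I] by simp

lemma ideal_pow_antimono: "m \<le> n \<Longrightarrow> ideal_pow I n \<subseteq> ideal_pow I m"
  by (rule lift_Suc_antimono_le) (use ideal_pow_Suc_subset in auto)

lemma mult_mem_ideal_pow:
  assumes "f \<in> ideal_pow I m" "g \<in> ideal_pow I n"
  shows "f * g \<in> ideal_pow I (m + n)"
proof -
  have "ideal_pow I (m + n) = ideal_prod ring_of_type_algebra (ideal_pow I m) (ideal_pow I n)"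
    using monoid.nat_pow_mult[OF monoid_ideals_set, of I m n] I by (simp add: ideals_set_def)
  then show ?thesis
    using ideal_prod.prod[OF assms, of ring_of_type_algebra] by simp
qed

lemma power_mem_ideal_pow: "f \<in> I \<Longrightarrow> f ^ n \<in> ideal_pow I n"
proof (induction n)
  case (Suc n)
  then show ?case
    using ideal_prod.prod[of "f ^ n" "ideal_pow I n" f I ring_of_type_algebra]
    by (simp add: mult.commute)
qed simp

lemma prod_power_mem_ideal_pow:
  "(\<And>i. i \<in> A \<Longrightarrow> f i \<in> I) \<Longrightarrow> (\<Prod>i\<in>A. f i ^ e i) \<in> ideal_pow I (\<Sum>i\<in>A. e i)"
  by (induction A rule: infinite_finite_induct) (auto intro: mult_mem_ideal_pow power_mem_ideal_pow)

lemma ideal_cong_mult: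
  assumes "f - f' \<in> I" "g - g' \<in> I"
  shows "f * g - f' * g' \<in> I"
proof -
  have "f * g - f' * g' = (f - f') * g + f' * (g - g')" by (simp add: algebra_simps)
  then show ?thesis using assms I by (simp add: ideal_add ideal_mult ideal_mult_right)
qed

lemma ideal_cong_power: "f - g \<in> I \<Longrightarrow> f ^ n - g ^ n \<in> I"
  by (induction n) (auto intro: ideal_cong_mult ideal_0[OF I])

lemma ideal_cong_prod: "(\<And>i. i \<in> A \<Longrightarrow> f i - g i \<in> I) \<Longrightarrow> prod f A - prod g A \<in> I"
  by (induction A rule: infinite_finite_induct) (auto intro: ideal_cong_mult ideal_0[OF I])

end

section \<open>Substitution homomorphisms\<close>

definition var :: "'n option + 'm option \<Rightarrow> ('k::field, 'n::finite, 'm::finite) bipoly" where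
  "var q = Poly_Mapping.single (Poly_Mapping.single q 1) 1"

lemma var_x_eq: "var_x i = var (Inl i)" and var_y_eq: "var_y j = var (Inr j)"
  by (simp_all add: var_x_def var_y_def var_def)

lemma var_power: "var q ^ n = Poly_Mapping.single (Poly_Mapping.single q n) 1"
  by (induction n) (simp_all add: var_def mult_single flip: single_add)

lemma single_eq_const_times_vars:
  fixes a :: "('n::finite, 'm::finite) bimonom" and c :: "'k::field"
  shows "Poly_Mapping.single a c = const c * (\<Prod>q\<in>UNIV. var q ^ Poly_Mapping.lookup a q)"
proof -
  have "(\<Prod>q\<in>A. (var q :: ('k, 'n, 'm) bipoly) ^ Poly_Mapping.lookup a q) =
      Poly_Mapping.single (\<Sum>q\<in>A. Poly_Mapping.single q (Poly_Mapping.lookup a q)) 1" for A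
    by (induction A rule: infinite_finite_induct) (simp_all add: var_power mult_single)
  moreover have "(\<Sum>q\<in>UNIV. Poly_Mapping.single q (Poly_Mapping.lookup a q)) = a"
    by (rule poly_mapping_eqI) (simp add: lookup_sum lookup_single when_def)
  ultimately show ?thesis by (simp add: const_def mult_single)
qed

text \<open>The \<open>k\<close>-algebra endomorphism that sends \<open>var q\<close> to
  \<open>g q\<close>.\<close>

definition subst ::
  "('n option + 'm option \<Rightarrow> ('k, 'n, 'm) bipoly) \<Rightarrow> ('k::field, 'n::finite, 'm::finite) bipoly \<Rightarrow>
     ('k, 'n, 'm) bipoly" where
  "subst g f = (\<Sum>a\<in>Poly_Mapping.keys f.
     const (Poly_Mapping.lookup f a) * (\<Prod>q\<in>UNIV. g q ^ Poly_Mapping.lookup a q))"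

lemma subst_superset:
  assumes "finite A" "Poly_Mapping.keys f \<subseteq> A"
  shows "subst g f = (\<Sum>a\<in>A. const (Poly_Mapping.lookup f a) * (\<Prod>q\<in>UNIV. g q ^ Poly_Mapping.lookup a q))"
  unfolding subst_def using assms by (intro sum.mono_neutral_left) (auto simp: in_keys_iff)

lemma subst_single:
  "subst g (Poly_Mapping.single a c) = const c * (\<Prod>q\<in>UNIV. g q ^ Poly_Mapping.lookup a q)"
  using subst_superset[of "{a}" "Poly_Mapping.single a c" g] by simp

lemma subst_add: "subst g (f + f') = subst g f + subst g f'"
  using subst_superset[of "Poly_Mapping.keys f \<union> Poly_Mapping.keys f'" f g]
    subst_superset[of "Poly_Mapping.keys f \<union> Poly_Mapping.keys f'" f' g]
    subst_superset[of "Poly_Mapping.keys f \<union> Poly_Mapping.keys f'" "f + f'" g]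
    keys_add[of f f']
  by (simp add: lookup_add const_add distrib_right sum.distrib)

lemma subst_mult: "subst g (f * f') = subst g f * subst g f'"
proof (induction f rule: poly_mapping_single_induct)
  case (single a c)
  show ?case
    by (induction f' rule: poly_mapping_single_induct)
      (simp_all add: mult_single subst_single lookup_add power_add prod.distrib const_mult
        distrib_left subst_add)
qed (simp add: distrib_right subst_add)

lemma subst_const [simp]: "subst g (const c) = const c"
  using subst_single[of g 0 c] by (simp add: const_def)

lemma subst_0 [simp]: "subst g 0 = 0" and subst_1 [simp]: "subst g 1 = 1"
  using subst_const[of g 0] subst_const[of g 1] by simp_all

lemma subst_var [simp]: "subst g (var q) = g q"
proof -
  have "(\<Prod>r\<in>UNIV. g r ^ Poly_Mapping.lookup (Poly_Mapping.single q 1) r) = (\<Prod>r\<in>UNIV. if r = q then g q else 1)"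
    by (rule prod.cong) (auto simp: lookup_single when_def)
  then show ?thesis by (simp add: var_def subst_single)
qed

lemma subst_power: "subst g (f ^ n) = subst g f ^ n"
  by (induction n) (simp_all add: subst_mult)

lemma subst_prod: "subst g (prod f A) = (\<Prod>i\<in>A. subst g (f i))"
  by (induction A rule: infinite_finite_induct) (simp_all add: subst_mult)

lemma subst_inverse:
  assumes "\<And>q. subst h (g q) = var q"
  shows "subst h (subst g f) = f"
proof (induction f rule: poly_mapping_single_induct)
  case (single a c)
  show ?case
    by (simp add: subst_single subst_mult subst_prod subst_power assms)
      (simp add: single_eq_const_times_vars)
qed (simp add: subst_add)

text \<open>The \<open>m\<close>-th power of the ideal generated by the variables in
  \<open>W\<close>. The description by exponents makes visible which variables are regular modulo
  it.\<close>

definition monomial_ideal ::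
  "('n option + 'm option) set \<Rightarrow> nat \<Rightarrow> ('k::field, 'n::finite, 'm::finite) bipoly set" where
  "monomial_ideal W m = {f. \<forall>a\<in>Poly_Mapping.keys f. m \<le> (\<Sum>q\<in>W. Poly_Mapping.lookup a q)}"

lemma mult_mem_monomial_ideal:
  "f \<in> monomial_ideal W m \<Longrightarrow> g \<in> monomial_ideal W n \<Longrightarrow> f * g \<in> monomial_ideal W (m + n)"
  using keys_mult[of f g]
  by (fastforce simp: monomial_ideal_def lookup_add sum.distrib intro: add_mono)

lemma monomial_ideal_0 [simp]: "monomial_ideal W 0 = UNIV"
  by (simp add: monomial_ideal_def)

lemma ideal_monomial_ideal: "ideal (monomial_ideal W m) coord_ring"
  unfolding ideal_type_algebra_iff
proof (intro conjI ballI allI)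
  show "f + g \<in> monomial_ideal W m" if "f \<in> monomial_ideal W m" "g \<in> monomial_ideal W m" for f g
    using that keys_add[of f g] by (fastforce simp: monomial_ideal_def)
  show "r * f \<in> monomial_ideal W m" if "f \<in> monomial_ideal W m" for f r
    using mult_mem_monomial_ideal[of r W 0 f m] that by simp
qed (simp add: monomial_ideal_def)

text \<open>Multiplication by a variable outside \<open>W\<close> leaves the degree in the variables
  of \<open>W\<close> unchanged.\<close>

lemma monomial_ideal_var_regular:
  assumes "q \<notin> W" "var q * f \<in> monomial_ideal W m"
  shows "f \<in> monomial_ideal W m"
  unfolding monomial_ideal_def
proof (intro CollectI ballI)
  fix a assume "a \<in> Poly_Mapping.keys f"
  then have "Poly_Mapping.single q 1 + a \<in> Poly_Mapping.keys (var q * f)"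
    unfolding var_def by (rule keys_single_mult)
  then have "m \<le> (\<Sum>r\<in>W. Poly_Mapping.lookup (Poly_Mapping.single q 1 + a) r)"
    using assms(2) unfolding monomial_ideal_def by blast
  also have "\<dots> = (\<Sum>r\<in>W. Poly_Mapping.lookup a r)"
    using assms(1) by (intro sum.cong) (auto simp: lookup_add lookup_single when_def)
  finally show "m \<le> (\<Sum>r\<in>W. Poly_Mapping.lookup a r)" .
qed

lemma var_mem_monomial_ideal: "q \<in> W \<Longrightarrow> var q \<in> monomial_ideal W 1"
  by (auto simp: monomial_ideal_def var_def lookup_single when_def)

text \<open>Each monomial of \<open>f\<close> turns into a multiple of a product of at least
  \<open>m\<close> elements of \<open>I\<close>.\<close>

lemma subst_mem_of_monomial_ideal:
  assumes I: "ideal I coord_ring" and "\<And>q. q \<in> W \<Longrightarrow> h q \<in> I" and f: "f \<in> monomial_ideal W m"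
  shows "subst h f \<in> ideal_pow I m"
  unfolding subst_def
proof (rule ideal_sum[OF ideal_ideal_pow[OF I]])
  fix a assume a: "a \<in> Poly_Mapping.keys f"
  have "(\<Prod>q\<in>UNIV. h q ^ Poly_Mapping.lookup a q) =
      (\<Prod>q\<in>W. h q ^ Poly_Mapping.lookup a q) * (\<Prod>q\<in>- W. h q ^ Poly_Mapping.lookup a q)"
    using prod.union_disjoint[of W "- W" "\<lambda>q. h q ^ Poly_Mapping.lookup a q"] by simp
  moreover have "(\<Prod>q\<in>W. h q ^ Poly_Mapping.lookup a q) \<in> ideal_pow I (\<Sum>q\<in>W. Poly_Mapping.lookup a q)"
    using assms(2) by (rule prod_power_mem_ideal_pow[OF I])
  then have "(\<Prod>q\<in>W. h q ^ Poly_Mapping.lookup a q) \<in> ideal_pow I m"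
    using ideal_pow_antimono[OF I, of m "\<Sum>q\<in>W. Poly_Mapping.lookup a q"] a f
    unfolding monomial_ideal_def by blast
  ultimately show "const (Poly_Mapping.lookup f a) * (\<Prod>q\<in>UNIV. h q ^ Poly_Mapping.lookup a q) \<in> ideal_pow I m"
    using ideal_mult[OF ideal_ideal_pow[OF I]] ideal_mult_right[OF ideal_ideal_pow[OF I]] by simp
qed

text \<open>The exponents of monomial ideals add under multiplication, so a homomorphism that takes
  \<open>I\<close> into the first one takes the \<open>m\<close>-th power of \<open>I\<close> into
  the \<open>m\<close>-th one.\<close>

lemma subst_mem_monomial_ideal:
  assumes I: "\<And>f. f \<in> I \<Longrightarrow> subst g f \<in> monomial_ideal W 1" and f: "f \<in> ideal_pow I m"
  shows "subst g f \<in> monomial_ideal W m"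
  using f
proof (induction m arbitrary: f)
  case (Suc m)
  note IH = Suc.IH
  from Suc.prems have "f \<in> ideal_prod coord_ring (ideal_pow I m) I" by simp
  then show ?case
  proof (induction f rule: ideal_prod.induct)
    case (prod i j)
    then show ?case using mult_mem_monomial_ideal[OF IH I, of i j] by (simp add: subst_mult)
  next
    case (sum f f')
    then show ?case by (simp add: subst_add ideal_add[OF ideal_monomial_ideal])
  qed
qed simp

section \<open>Ideals of fat points\<close>

lemma bieval_superset:
  assumes "finite A" "Poly_Mapping.keys f \<subseteq> A"
  shows "bieval u v f = (\<Sum>a\<in>A. Poly_Mapping.lookup f a
      * (\<Prod>i\<in>UNIV. u i ^ Poly_Mapping.lookup a (Inl i))
      * (\<Prod>j\<in>UNIV. v j ^ Poly_Mapping.lookup a (Inr j)))"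
  unfolding bieval_def using assms by (intro sum.mono_neutral_left) (auto simp: in_keys_iff)

lemma bieval_diff: "bieval u v (f - g) = bieval u v f - bieval u v g"
  using bieval_superset[of "Poly_Mapping.keys f \<union> Poly_Mapping.keys g" f u v]
    bieval_superset[of "Poly_Mapping.keys f \<union> Poly_Mapping.keys g" g u v]
    bieval_superset[of "Poly_Mapping.keys f \<union> Poly_Mapping.keys g" "f - g" u v]
    keys_diff[of f g]
  by (simp add: lookup_minus left_diff_distrib sum_subtractf)

lemma bieval_const_mult: "bieval u v (const c * f) = c * bieval u v f"
proof -
  have "Poly_Mapping.keys (const c * f) \<subseteq> Poly_Mapping.keys f"
    by (auto simp: in_keys_iff lookup_const_mult)
  then show ?thesis
    using bieval_superset[of "Poly_Mapping.keys f" "const c * f" u v]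
    by (simp add: bieval_def lookup_const_mult sum_distrib_left mult.assoc)
qed

lemma prod_power_single:
  "(\<Prod>k\<in>UNIV. u k ^ Poly_Mapping.lookup (Poly_Mapping.single (h i) 1) (h k)) = u i"
  if "inj h" for u :: "'i::finite \<Rightarrow> 'k::comm_semiring_1"
proof -
  have "(\<Prod>k\<in>UNIV. u k ^ Poly_Mapping.lookup (Poly_Mapping.single (h i) 1) (h k)) =
      (\<Prod>k\<in>UNIV. if k = i then u i else 1)"
    using that by (intro prod.cong) (auto simp: lookup_single when_def inj_eq)
  then show ?thesis by simp
qed

lemma bieval_var_x: "bieval u v (var_x i) = u i"
  using prod_power_single[of Inl u i] by (simp add: bieval_def var_x_def lookup_single when_def)

lemma bieval_var_y: "bieval u v (var_y j) = v j"
  using prod_power_single[of Inr v j] by (simp add: bieval_def var_y_def lookup_single when_def)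

text \<open>All vectors of a class are nonzero multiples of one \<open>w0\<close>, so
  \<open>w0\<close> has a nonzero coordinate \<open>i\<close> and can be divided by it.\<close>

lemma proj_space_normalized:
  assumes "A \<in> proj_space" "w \<in> A" "w i \<noteq> 0"
  obtains u where "u \<in> A" "u i = 1" "\<forall>v\<in>A. \<exists>c. v = (\<lambda>k. c * u k)"
proof -
  obtain w0 where A: "A = {v. \<exists>c. c \<noteq> 0 \<and> v = (\<lambda>k. c * w0 k)}"
    using assms(1) by (auto simp: proj_space_def quotient_def)
  have w0: "w0 i \<noteq> 0" using assms(2,3) A by auto
  show thesis
  proof (rule that[of "\<lambda>k. (1 / w0 i) * w0 k"])
    show "(\<lambda>k. 1 / w0 i * w0 k) \<in> A" unfolding A using w0 by (auto intro!: exI[of _ "1 / w0 i"])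
    show "1 / w0 i * w0 i = 1" using w0 by simp
    show "\<forall>v\<in>A. \<exists>c. v = (\<lambda>k. c * (1 / w0 i * w0 k))"
    proof
      fix v assume v: "v \<in> A"
      obtain c where "v = (\<lambda>k. c * w0 k)" using v A by auto
      then show "\<exists>c. v = (\<lambda>k. c * (1 / w0 i * w0 k))"
        using w0 by (auto intro!: exI[of _ "c * w0 i"])
    qed
  qed
qed

definition off_axes :: "('k::field, 'n::finite, 'm::finite) bipoint \<Rightarrow> bool" where
  "off_axes P \<longleftrightarrow> P \<in> biproj_space \<and> \<not> vanishes_at (var_x None) P \<and> \<not> vanishes_at (var_y None) P"

lemma off_axes_normalized:
  assumes "off_axes P"
  obtains u v where "u \<in> fst P" "v \<in> snd P" "u None = 1" "v None = 1"
    "\<forall>u'\<in>fst P. \<exists>c. u' = (\<lambda>k. c * u k)" "\<forall>v'\<in>snd P. \<exists>c. v' = (\<lambda>k. c * v k)"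
proof -
  obtain u0 v0 where "u0 \<in> fst P" "u0 None \<noteq> 0" "v0 \<in> snd P" "v0 None \<noteq> 0"
    using assms unfolding off_axes_def vanishes_at_def bieval_var_x bieval_var_y by blast
  moreover have "fst P \<in> proj_space" "snd P \<in> proj_space"
    using assms by (auto simp: off_axes_def biproj_space_def)
  ultimately obtain u v where "u \<in> fst P" "u None = 1" "\<forall>u'\<in>fst P. \<exists>c. u' = (\<lambda>k. c * u k)"
    and "v \<in> snd P" "v None = 1" "\<forall>v'\<in>snd P. \<exists>c. v' = (\<lambda>k. c * v k)"
    using proj_space_normalized[of "fst P" u0 None] proj_space_normalized[of "snd P" v0 None]
    by (metis (no_types))
  then show thesis by (intro that)
qed

lemma mem_point_ideal: "biform f \<Longrightarrow> vanishes_at f P \<Longrightarrow> f \<in> point_ideal P"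
  using subset_gen[of "{f. biform f \<and> vanishes_at f P}"] by (auto simp: point_ideal_def)

lemma ideal_point_ideal: "ideal (point_ideal P) coord_ring"
  unfolding point_ideal_def by (rule ideal_gen)

lemma bigraded_point_ideal: "bigraded (point_ideal P)"
  unfolding point_ideal_def by (rule bigraded_gen_biforms) simp

lemma bigraded_ideal_pow: "ideal I coord_ring \<Longrightarrow> bigraded I \<Longrightarrow> bigraded (ideal_pow I n)"
  by (induction n) (auto simp: bigraded_def[of UNIV] intro: bigraded_ideal_prod ideal_ideal_pow)

text \<open>Every representative is a multiple of \<open>u\<close> or \<open>v\<close>, whose
  coordinate at \<open>None\<close> is 1, so these linear forms vanish at \<open>P\<close>.\<close>

lemma point_ideal_linear:
  assumes "u None = 1" "v None = 1"
    and "\<forall>u'\<in>fst P. \<exists>c. u' = (\<lambda>k. c * u k)" "\<forall>v'\<in>snd P. \<exists>c. v' = (\<lambda>k. c * v k)"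
  shows "var_x i - const (u i) * var_x None \<in> point_ideal P"
    and "var_y j - const (v j) * var_y None \<in> point_ideal P"
proof -
  have "bihomogeneous (1, 0) (var_x i - const (u i) * var_x None)"
    using bihomogeneous_mult[OF bihomogeneous_const bihomogeneous_var_x]
    by (intro bihomogeneous_diff bihomogeneous_var_x) simp
  moreover have "vanishes_at (var_x i - const (u i) * var_x None) P"
    unfolding vanishes_at_def bieval_diff bieval_const_mult bieval_var_x
  proof (intro ballI)
    fix u' v' assume "u' \<in> fst P"
    then obtain c where "u' = (\<lambda>k. c * u k)" using assms(3) by blast
    then show "u' i - u i * u' None = 0" using assms(1) by simp
  qed
  ultimately show "var_x i - const (u i) * var_x None \<in> point_ideal P"
    by (intro mem_point_ideal) (auto simp: biform_def)
  have "bihomogeneous (0, 1) (var_y j - const (v j) * var_y None)"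
    using bihomogeneous_mult[OF bihomogeneous_const bihomogeneous_var_y]
    by (intro bihomogeneous_diff bihomogeneous_var_y) simp
  moreover have "vanishes_at (var_y j - const (v j) * var_y None) P"
    unfolding vanishes_at_def bieval_diff bieval_const_mult bieval_var_y
  proof (intro ballI)
    fix u' v' assume "v' \<in> snd P"
    then obtain c where "v' = (\<lambda>k. c * v k)" using assms(4) by blast
    then show "v' j - v j * v' None = 0" using assms(2) by simp
  qed
  ultimately show "var_y j - const (v j) * var_y None \<in> point_ideal P"
    by (intro mem_point_ideal) (auto simp: biform_def)
qed

text \<open>The coordinates of the affine chart where x_0 and y_0 are 1.\<close>

definition affine_vars :: "('n option + 'm option) set" where
  "affine_vars = - {Inl None, Inr None}"

definition base_var :: "'n option + 'm option \<Rightarrow> 'n option + 'm option" where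
  "base_var q = (case q of Inl _ \<Rightarrow> Inl None | Inr _ \<Rightarrow> Inr None)"

text \<open>The homogeneous version of an affine translation: it sends
  \<open>var q - const (w q) * var (base_var q)\<close> to \<open>var q\<close> for affine
  \<open>q\<close>, and it fixes x_0 and y_0.\<close>

definition translation ::
  "('n option + 'm option \<Rightarrow> 'k) \<Rightarrow> 'n option + 'm option \<Rightarrow> ('k::field, 'n::finite, 'm::finite) bipoly"
  where
  "translation w q = (if q \<in> affine_vars then var q + const (w q) * var (base_var q) else var q)"

lemma base_var_not_affine [simp]: "base_var q \<notin> affine_vars"
  by (simp add: base_var_def affine_vars_def split: sum.split)

lemma base_var_eq: "q \<notin> affine_vars \<Longrightarrow> base_var q = q"
  by (auto simp: base_var_def affine_vars_def)

lemma translation_inverse: "subst (translation (\<lambda>q. - w q)) (subst (translation w) f) = f"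
proof (rule subst_inverse)
  fix q
  show "subst (translation (\<lambda>q. - w q)) (translation w q) = var q"
    by (simp add: translation_def subst_add subst_mult const_uminus)
qed

text \<open>
  After the translation, a form of bidegree \<open>(d, e)\<close> agrees with its value at the point times
  \<open>x\<^sub>0\<^sup>d y\<^sub>0\<^sup>e\<close> up to multiples of the other variables.
\<close>
lemma translation_form:
  fixes f :: "('k::field, 'n::finite, 'm::finite) bipoly"
  assumes uv: "u None = 1" "v None = 1" and f: "bihomogeneous (d, e) f"
  shows "subst (translation (case_sum u v)) f - const (bieval u v f) * (var_x None ^ d * var_y None ^ e)
    \<in> monomial_ideal affine_vars 1"
proof -
  let ?M = "monomial_ideal affine_vars 1 :: ('k, 'n, 'm) bipoly set"
  let ?w = "case_sum u v" and ?lk = Poly_Mapping.lookup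
  have M: "ideal ?M coord_ring" by (rule ideal_monomial_ideal)
  \<comment> \<open>For x_0 and y_0 this rests on the normalization, which makes \<open>?w q\<close>
    equal to 1.\<close>
  have q: "translation ?w q - const (?w q) * var (base_var q) \<in> ?M" for q
  proof (cases "q \<in> affine_vars")
    case True
    then show ?thesis by (simp add: translation_def var_mem_monomial_ideal[unfolded One_nat_def])
  next
    case False
    then have "?w q = 1" using uv by (auto simp: affine_vars_def)
    with False show ?thesis using ideal_0[OF M] by (simp add: translation_def base_var_eq)
  qed
  have UNIV_prod: "(\<Prod>q\<in>UNIV. g q) = (\<Prod>i\<in>UNIV. g (Inl i)) * (\<Prod>j\<in>UNIV. g (Inr j))"
    for g :: "'n option + 'm option \<Rightarrow> ('k, 'n, 'm) bipoly"
    using prod.Plus[of "UNIV :: 'n option set" "UNIV :: 'm option set" g] by simp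
  \<comment> \<open>As \<open>f\<close> is bihomogeneous, all its monomials yield the same power
    product of x_0 and y_0, which can be factored out.\<close>
  have monom: "(\<Prod>q\<in>UNIV. (const (?w q) * var (base_var q)) ^ ?lk a q) =
      const ((\<Prod>i\<in>UNIV. u i ^ ?lk a (Inl i)) * (\<Prod>j\<in>UNIV. v j ^ ?lk a (Inr j)))
        * (var_x None ^ d * var_y None ^ e)" if "a \<in> Poly_Mapping.keys f" for a
  proof -
    have "d = (\<Sum>i\<in>UNIV. ?lk a (Inl i))" "e = (\<Sum>j\<in>UNIV. ?lk a (Inr j))"
      using f that by (auto simp: bihomogeneous_def monom_bidegree_def)
    then show ?thesis
      by (simp add: UNIV_prod base_var_def power_mult_distrib prod.distrib const_mult const_prod
          const_power power_sum var_x_eq var_y_eq ac_simps)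
  qed
  have "subst (translation ?w) f - const (bieval u v f) * (var_x None ^ d * var_y None ^ e) =
    (\<Sum>a\<in>Poly_Mapping.keys f. const (?lk f a) * ((\<Prod>q\<in>UNIV. translation ?w q ^ ?lk a q) -
        (\<Prod>q\<in>UNIV. (const (?w q) * var (base_var q)) ^ ?lk a q)))"
    unfolding subst_def bieval_def const_sum sum_distrib_right right_diff_distrib sum_subtractf
    by (intro arg_cong2[of _ _ _ _ minus] sum.cong refl) (simp add: monom const_mult mult.assoc)
  also have "\<dots> \<in> ?M"
    by (intro ideal_sum[OF M] ideal_mult[OF M] ideal_cong_prod[OF M] ideal_cong_power[OF M] q)
  finally show ?thesis .
qed

text \<open>The translation carries the power of the point ideal into a monomial ideal and fixes
  \<open>var q\<close>, which is cancelled there; the inverse translation leads back into the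
  power.\<close>

lemma point_ideal_pow_regular:
  fixes P :: "('k::field, 'n::finite, 'm::finite) bipoint"
  assumes P: "off_axes P" and q: "q \<notin> affine_vars" and f: "var q * f \<in> ideal_pow (point_ideal P) m"
  shows "f \<in> ideal_pow (point_ideal P) m"
proof -
  obtain u v where uv: "u \<in> fst P" "v \<in> snd P" "u None = 1" "v None = 1"
    and mult: "\<forall>u'\<in>fst P. \<exists>c. u' = (\<lambda>k. c * u k)" "\<forall>v'\<in>snd P. \<exists>c. v' = (\<lambda>k. c * v k)"
    by (rule off_axes_normalized[OF P])
  let ?w = "case_sum u v"
  let ?T = "{f :: ('k, 'n, 'm) bipoly. subst (translation ?w) f \<in> monomial_ideal affine_vars 1}"
  have M: "ideal (monomial_ideal affine_vars 1 :: ('k, 'n, 'm) bipoly set) coord_ring"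
    by (rule ideal_monomial_ideal)
  have "ideal ?T coord_ring"
    unfolding ideal_type_algebra_iff
    using ideal_0[OF M] ideal_add[OF M] ideal_mult[OF M] by (simp add: subst_add subst_mult)
  moreover have "{f. biform f \<and> vanishes_at f P} \<subseteq> ?T"
  proof
    fix f assume "f \<in> {f. biform f \<and> vanishes_at f P}"
    then obtain d e where "bihomogeneous (d, e) f" "bieval u v f = 0"
      using uv by (auto simp: biform_def vanishes_at_def)
    then show "f \<in> ?T" using translation_form[of u v d e f, OF uv(3,4)] by simp
  qed
  ultimately have "point_ideal P \<subseteq> ?T"
    unfolding point_ideal_def by (rule gen_minimal)
  then have "subst (translation ?w) g \<in> monomial_ideal affine_vars 1" if "g \<in> point_ideal P" for g
    using that by blast
  then have "subst (translation ?w) (var q * f) \<in> monomial_ideal affine_vars m"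
    using f by (rule subst_mem_monomial_ideal)
  then have "subst (translation ?w) f \<in> monomial_ideal affine_vars m"
    using monomial_ideal_var_regular[OF q, of "subst (translation ?w) f" m] q
    by (simp add: subst_mult translation_def)
  \<comment> \<open>The inverse translation sends the affine variables to the linear forms of
    \<open>point_ideal_linear\<close>.\<close>
  moreover have "translation (\<lambda>q. - ?w q) q \<in> point_ideal P" if "q \<in> affine_vars" for q
    using point_ideal_linear[of u v P, OF uv(3,4) mult] that
    by (cases q) (auto simp: translation_def base_var_def const_uminus var_x_eq var_y_eq)
  ultimately have "subst (translation (\<lambda>q. - ?w q)) (subst (translation ?w) f) \<in> ideal_pow (point_ideal P) m"
    by (intro subst_mem_of_monomial_ideal ideal_point_ideal)
  then show ?thesis by (simp add: translation_inverse)
qed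

section \<open>Fat ideals: grading, regular variables and nilpotence\<close>

lemma ideal_fat_ideal: "ideal (fat_ideal Z) coord_ring"
  unfolding ideal_type_algebra_iff fat_ideal_def
  by (auto intro: ideal_0 ideal_add ideal_mult ideal_ideal_pow ideal_point_ideal)

lemma bigraded_fat_ideal: "bigraded (fat_ideal Z)"
  unfolding fat_ideal_def
  by (rule bigraded_Inter) (auto intro: bigraded_ideal_pow ideal_point_ideal bigraded_point_ideal)

lemma fat_ideal_antimono:
  assumes "\<And>P. Z' P \<le> Z P"
  shows "fat_ideal Z \<subseteq> fat_ideal Z'"
proof -
  have "P \<in> supp Z" if "P \<in> supp Z'" for P
    using that assms[of P] by (simp add: supp_def)
  then show ?thesis
    unfolding fat_ideal_def using ideal_pow_antimono[OF ideal_point_ideal assms]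
    by (intro INF_mono) blast
qed

lemma fat_ideal_regular:
  assumes "\<And>P. P \<in> supp Z \<Longrightarrow> off_axes P" "q \<notin> affine_vars" "var q * f \<in> fat_ideal Z"
  shows "f \<in> fat_ideal Z"
  unfolding fat_ideal_def
proof
  fix P assume P: "P \<in> supp Z"
  then have "var q * f \<in> ideal_pow (point_ideal P) (Z P)"
    using assms(3) by (simp add: fat_ideal_def)
  then show "f \<in> ideal_pow (point_ideal P) (Z P)"
    by (rule point_ideal_pow_regular[OF assms(1)[OF P] assms(2)])
qed

text \<open>The product of the powers \<open>(g - const (c P) * h) ^ Z P\<close> lies in the fat
  ideal and is congruent modulo \<open>h\<close> to a power of \<open>g\<close>; \<open>N\<close> is
  the sum of the multiplicities.\<close>

lemma power_mem_of_linear: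
  assumes "finite (supp Z)" "\<And>P. P \<in> supp Z \<Longrightarrow> \<exists>c. g - const c * h \<in> point_ideal P"
  shows "\<exists>N. g ^ N \<in> gen (insert h (fat_ideal Z))"
proof -
  let ?K = "gen (insert h (fat_ideal Z))"
  have K: "ideal ?K coord_ring" by (rule ideal_gen)
  obtain c where c: "\<And>P. P \<in> supp Z \<Longrightarrow> g - const (c P) * h \<in> point_ideal P"
    using assms(2) by metis
  have "(\<Prod>P\<in>supp Z. (g - const (c P) * h) ^ Z P) \<in> ideal_pow (point_ideal Q) (Z Q)"
    if Q: "Q \<in> supp Z" for Q
  proof -
    have "(g - const (c Q) * h) ^ Z Q \<in> ideal_pow (point_ideal Q) (Z Q)"
      by (intro power_mem_ideal_pow ideal_point_ideal c Q)
    then show ?thesis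
      by (subst prod.remove[OF assms(1) Q])
        (intro ideal_mult_right[OF ideal_ideal_pow[OF ideal_point_ideal]])
  qed
  then have "(\<Prod>P\<in>supp Z. (g - const (c P) * h) ^ Z P) \<in> fat_ideal Z"
    by (simp add: fat_ideal_def)
  then have prod: "(\<Prod>P\<in>supp Z. (g - const (c P) * h) ^ Z P) \<in> ?K"
    using subset_gen[of "insert h (fat_ideal Z)"] by blast
  have diff: "(\<Prod>P\<in>supp Z. g ^ Z P) - (\<Prod>P\<in>supp Z. (g - const (c P) * h) ^ Z P) \<in> ?K"
  proof (intro ideal_cong_prod[OF K] ideal_cong_power[OF K])
    have "h \<in> ?K" using subset_gen[of "insert h (fat_ideal Z)"] by blast
    then show "g - (g - const (c P) * h) \<in> ?K" for P by (simp add: ideal_mult[OF K])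
  qed
  have "(\<Prod>P\<in>supp Z. g ^ Z P) \<in> ?K"
    using ideal_add[OF K diff prod] by simp
  then show ?thesis by (auto simp flip: power_sum)
qed

lemma fat_ideal_var_nilpotent:
  assumes "finite (supp Z)" "\<And>P. P \<in> supp Z \<Longrightarrow> off_axes P"
  shows "\<exists>N. var_x i ^ N \<in> gen (insert (var_x None) (fat_ideal Z))"
    and "\<exists>N. var_y j ^ N \<in> gen (insert (var_y None) (fat_ideal Z))"
proof -
  have "\<exists>a b. var_x i - const a * var_x None \<in> point_ideal P \<and> var_y j - const b * var_y None \<in> point_ideal P"
    if P: "P \<in> supp Z" for P
  proof -
    obtain u v where "u None = 1" "v None = 1"
      and "\<forall>u'\<in>fst P. \<exists>c. u' = (\<lambda>k. c * u k)" "\<forall>v'\<in>snd P. \<exists>c. v' = (\<lambda>k. c * v k)"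
      by (rule off_axes_normalized[OF assms(2)[OF P]])
    note point_ideal_linear[of u v P, OF this]
    then show ?thesis by blast
  qed
  then show "\<exists>N. var_x i ^ N \<in> gen (insert (var_x None) (fat_ideal Z))"
    "\<exists>N. var_y j ^ N \<in> gen (insert (var_y None) (fat_ideal Z))"
    by (intro power_mem_of_linear[OF assms(1)]; blast)+
qed

section \<open>Separators\<close>

lemma residue_class_eq: "residue_class Z = (+>\<^bsub>coord_ring\<^esub>) (fat_ideal Z)"
  by (simp add: residue_class_def fun_eq_iff)

lemma carrier_fat_ring: "carrier (fat_ring Z) = range (residue_class Z)"
  by (auto simp: fat_ring_def FactRing_def A_RCOSETS_def' residue_class_def)

lemma ring_fat_ring: "ring (fat_ring Z)"
  unfolding fat_ring_def by (rule ideal.quotient_is_ring[OF ideal_fat_ideal])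

lemma residue_class_hom: "residue_class Z \<in> ring_hom coord_ring (fat_ring Z)"
  unfolding fat_ring_def residue_class_eq by (rule ideal.rcos_ring_hom[OF ideal_fat_ideal])

lemma residue_class_mult: "residue_class Z (f * g) = residue_class Z f \<otimes>\<^bsub>fat_ring Z\<^esub> residue_class Z g"
  and residue_class_add: "residue_class Z (f + g) = residue_class Z f \<oplus>\<^bsub>fat_ring Z\<^esub> residue_class Z g"
  using ring_hom_mult[OF residue_class_hom] ring_hom_add[OF residue_class_hom] by force+

lemma residue_class_zero: "residue_class Z 0 = \<zero>\<^bsub>fat_ring Z\<^esub>"
  using ring_hom_zero[OF residue_class_hom type_algebra.ring_axioms ring_fat_ring] by simp

lemma residue_class_eq_iff: "residue_class Z f = residue_class Z g \<longleftrightarrow> f - g \<in> fat_ideal Z"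
  using type_algebra.quotient_eq_iff_same_a_r_cos[OF ideal_fat_ideal, of f g Z]
  by (simp add: residue_class_def a_minus_def)

lemma residue_class_mem_genideal_iff:
  "residue_class Z f \<in> genideal (fat_ring Z) (residue_class Z ` S) \<longleftrightarrow> f \<in> gen (fat_ideal Z \<union> S)"
  unfolding fat_ring_def residue_class_eq
  by (rule type_algebra.mem_genideal_quotient_iff[OF ideal_fat_ideal]) simp_all

lemma genideal_fat_ring_eq:
  "genideal (fat_ring Z) (residue_class Z ` S) = residue_class Z ` gen (fat_ideal Z \<union> S)"
proof -
  have "residue_class Z ` S \<subseteq> carrier (fat_ring Z)" unfolding carrier_fat_ring by blast
  then have G: "ideal (genideal (fat_ring Z) (residue_class Z ` S)) (fat_ring Z)"
    by (rule ring.genideal_ideal[OF ring_fat_ring])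
  have "r \<in> residue_class Z ` gen (fat_ideal Z \<union> S)"
    if r: "r \<in> genideal (fat_ring Z) (residue_class Z ` S)" for r
  proof -
    have "r \<in> carrier (fat_ring Z)" using r by (rule ideal.Icarr[OF G])
    then obtain f where "r = residue_class Z f" unfolding carrier_fat_ring by blast
    with r show ?thesis by (simp add: residue_class_mem_genideal_iff)
  qed
  moreover have "residue_class Z f \<in> genideal (fat_ring Z) (residue_class Z ` S)"
    if "f \<in> gen (fat_ideal Z \<union> S)" for f
    using that by (simp add: residue_class_mem_genideal_iff)
  ultimately show ?thesis by blast
qed

text \<open>Regularity of an entry involves only its predecessors, so the first two entries of a
  regular sequence of length at least two can be lifted and read modulo the fat ideal.\<close>

lemma ACM_regular_sequence:
  assumes "ACM Z"
  obtains a b where "a \<in> irrelevant_ideal" "b \<in> irrelevant_ideal"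
    "\<forall>f. a * f \<in> fat_ideal Z \<longrightarrow> f \<in> fat_ideal Z"
    "\<forall>f. b * f \<in> gen (insert a (fat_ideal Z)) \<longrightarrow> f \<in> gen (insert a (fat_ideal Z))"
proof -
  let ?q = "residue_class Z ` irrelevant_ideal"
  have "depth (fat_ring Z) ?q = 2" using assms by (simp add: ACM_def)
  then have "1 < Sup {enat (length xs) | xs. set xs \<subseteq> ?q \<and> regular_sequence (fat_ring Z) xs}"
    by (simp add: depth_def)
  then obtain xs where xs: "1 < enat (length xs)" "set xs \<subseteq> ?q" "regular_sequence (fat_ring Z) xs"
    unfolding less_Sup_iff by blast
  then have len: "1 < length xs" by (simp add: one_enat_def)
  then have pos: "0 < length xs" by linarith
  with len have "xs ! 0 \<in> ?q" "xs ! 1 \<in> ?q"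
    by (blast intro: subsetD[OF xs(2)] nth_mem)+
  then obtain a b where a: "a \<in> irrelevant_ideal" "xs ! 0 = residue_class Z a"
    and b: "b \<in> irrelevant_ideal" "xs ! 1 = residue_class Z b" by blast
  have reg: "r \<in> genideal (fat_ring Z) (set (take i xs))"
    if "i < length xs" "r \<in> carrier (fat_ring Z)" "(xs ! i) \<otimes>\<^bsub>fat_ring Z\<^esub> r \<in> genideal (fat_ring Z) (set (take i xs))" for i r
    using xs(3) that unfolding regular_sequence_def by blast
  \<comment> \<open>Written as images under \<open>residue_class Z\<close>, the predecessors fit
    \<open>residue_class_mem_genideal_iff\<close>.\<close>
  have take: "set (take 0 xs) = residue_class Z ` {}" "set (take 1 xs) = residue_class Z ` {a}"
    using len a(2) by (cases xs; simp)+
  have "f \<in> fat_ideal Z" if "a * f \<in> fat_ideal Z" for f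
    using reg[of 0 "residue_class Z f"] pos that
    unfolding take a(2) residue_class_mult[symmetric] residue_class_mem_genideal_iff
    by (simp add: gen_ideal[OF ideal_fat_ideal] carrier_fat_ring)
  moreover have "f \<in> gen (insert a (fat_ideal Z))" if "b * f \<in> gen (insert a (fat_ideal Z))" for f
    using reg[of 1 "residue_class Z f"] len that
    unfolding take b(2) residue_class_mult[symmetric] residue_class_mem_genideal_iff
    by (simp add: carrier_fat_ring)
  ultimately show thesis using that a(1) b(1) by blast
qed

text \<open>Each variable has a power in the ideal generated by x_0, y_0 and the fat ideal, so
  \<open>parameter_regular\<close> trades the abstract sequence \<open>a\<close>, \<open>b\<close>
  for x_0, y_0.\<close>

lemma ACM_regular:
  fixes Z :: "('k::field, 'n::finite, 'm::finite) bipoint \<Rightarrow> nat"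
  assumes "finite (supp Z)" "\<And>P. P \<in> supp Z \<Longrightarrow> off_axes P" "ACM Z"
    and f: "var_y None * f \<in> gen (insert (var_x None) (fat_ideal Z))"
  shows "f \<in> gen (insert (var_x None) (fat_ideal Z))"
proof -
  obtain a b where ab: "a \<in> irrelevant_ideal" "b \<in> irrelevant_ideal"
    "\<forall>f. a * f \<in> fat_ideal Z \<longrightarrow> f \<in> fat_ideal Z"
    "\<forall>f. b * f \<in> gen (insert a (fat_ideal Z)) \<longrightarrow> f \<in> gen (insert a (fat_ideal Z))"
    by (rule ACM_regular_sequence[OF assms(3)])
  let ?x = "var_x None :: ('k, 'n, 'm) bipoly" and ?y = "var_y None :: ('k, 'n, 'm) bipoly"
  let ?V = "range var_x \<union> range var_y :: ('k, 'n, 'm) bipoly set"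
  have nilp: "\<exists>N. v ^ N \<in> gen (insert ?y (insert ?x (fat_ideal Z)))" if v: "v \<in> ?V" for v
  proof -
    have "gen (insert ?x (fat_ideal Z)) \<subseteq> gen (insert ?y (insert ?x (fat_ideal Z)))"
      "gen (insert ?y (fat_ideal Z)) \<subseteq> gen (insert ?y (insert ?x (fat_ideal Z)))"
      by (intro gen_mono; blast)+
    with v fat_ideal_var_nilpotent[OF assms(1,2)] show ?thesis by fast
  qed
  have x: "g \<in> fat_ideal Z" if "?x * g \<in> fat_ideal Z" for g
    using fat_ideal_regular[OF assms(2), of Z "Inl None" g] that
    by (simp add: affine_vars_def var_x_eq)
  show ?thesis
  proof (rule parameter_regular[where V = ?V and a = a and b = b, OF ideal_fat_ideal x])
    show "a \<in> gen ?V" "b \<in> gen ?V" using ab(1,2) by (simp_all add: irrelevant_ideal_def)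
  qed (use ab(3,4) nilp f in simp_all)
qed

section \<open>Relations among minimal generators\<close>

lemma regular_power:
  fixes K :: "'a::comm_ring_1 set"
  assumes "\<And>f. x * f \<in> K \<Longrightarrow> f \<in> K" "x ^ n * f \<in> K"
  shows "f \<in> K"
  using assms(2) by (induction n) (auto simp: mult.assoc intro: assms(1))

text \<open>
  In a relation among the multiples of minimal generators, comparing the terms in which \<open>x\<^sub>0\<close>
  and then \<open>y\<^sub>0\<close> occur to the lowest power puts a scalar multiple of some generator, up to
  \<open>x\<^sub>0\<close> times a multiple of itself, in the ideal of the others.
\<close>
lemma minimal_generators_relation_trivial:
  fixes I :: "('k::field, 'n::finite, 'm::finite) bipoly set"
  assumes I: "ideal I coord_ring" "bigraded I"
    and J: "J = gen (I \<union> S)"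
    and S: "finite S" "\<And>f. f \<in> S \<Longrightarrow> biform f"
    and minimal: "\<And>f. f \<in> S \<Longrightarrow> f \<notin> gen (I \<union> (S - {f}))"
    and xI: "\<And>f. var_x None * f \<in> I \<Longrightarrow> f \<in> I"
    and xJ: "\<And>f. var_x None * f \<in> J \<Longrightarrow> f \<in> J"
    and y: "\<And>f. var_y None * f \<in> gen (insert (var_x None) I) \<Longrightarrow> f \<in> gen (insert (var_x None) I)"
    and A: "A \<subseteq> S" "\<And>f. f \<in> A \<Longrightarrow> fst (bidegree f) \<le> t1 \<and> snd (bidegree f) \<le> t2"
    and rel: "(\<Sum>f\<in>A. const (c f) * (var_x None ^ (t1 - fst (bidegree f))
      * var_y None ^ (t2 - snd (bidegree f)) * f)) \<in> I"
  shows "\<forall>f\<in>A. c f = 0"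
proof (rule ccontr)
  let ?x = "var_x None :: ('k, 'n, 'm) bipoly" and ?y = "var_y None :: ('k, 'n, 'm) bipoly"
  define d1 d2 :: "('k, 'n, 'm) bipoly \<Rightarrow> nat"
    where "d1 f = fst (bidegree f)" and "d2 f = snd (bidegree f)" for f
  \<comment> \<open>Only terms with nonzero coefficient are kept, so that the coefficient of the
    generator \<open>f0\<close> chosen below is invertible.\<close>
  define B where "B = {f \<in> A. c f \<noteq> 0}"
  assume "\<not> (\<forall>f\<in>A. c f = 0)"
  then have "B \<noteq> {}" by (auto simp: B_def)
  have finA: "finite A" using A(1) S(1) by (rule finite_subset)
  then have finB: "finite B" by (simp add: B_def)
  have BA: "B \<subseteq> A" by (auto simp: B_def)
  \<comment> \<open>The largest x-degree belongs to the lowest power of x_0, so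
    \<open>?x ^ (t1 - e1)\<close> divides all terms; \<open>C\<close> collects the terms free of x_0
    after this factor is cancelled.\<close>
  define e1 where "e1 = Max (d1 ` B)"
  have e1: "d1 f \<le> e1" if "f \<in> B" for f using finB that by (simp add: e1_def)
  have "e1 \<in> d1 ` B" unfolding e1_def using finB \<open>B \<noteq> {}\<close> by (intro Max_in) auto
  define C where "C = {f \<in> B. d1 f = e1}"
  have CB: "C \<subseteq> B" by (auto simp: C_def)
  have "C \<noteq> {}" using \<open>e1 \<in> d1 ` B\<close> by (auto simp: C_def)
  have finC: "finite C" using CB finB by (rule finite_subset)
  define e2 where "e2 = Max (d2 ` C)"
  have e2: "d2 f \<le> e2" if "f \<in> C" for f using finC that by (simp add: e2_def)
  have "e2 \<in> d2 ` C" unfolding e2_def using finC \<open>C \<noteq> {}\<close> by (intro Max_in) auto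
  then obtain f0 where f0: "f0 \<in> C" "d2 f0 = e2" by auto
  have e1t: "e1 \<le> t1" using \<open>e1 \<in> d1 ` B\<close> A(2) BA by (auto simp: d1_def)
  have e2t: "e2 \<le> t2" using f0 A(2) BA CB by (auto simp: d2_def)

  let ?Ix = "gen (insert ?x I)"
  have Ix: "ideal ?Ix coord_ring" by (rule ideal_gen)
  have xIx: "?x \<in> ?Ix" "I \<subseteq> ?Ix" using subset_gen[of "insert ?x I"] by auto
  have "(\<Sum>f\<in>A. const (c f) * (?x ^ (t1 - d1 f) * ?y ^ (t2 - d2 f) * f)) =
      (\<Sum>f\<in>B. const (c f) * (?x ^ (t1 - d1 f) * ?y ^ (t2 - d2 f) * f))"
    by (rule sum.mono_neutral_right[OF finA BA]) (auto simp: B_def)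
  also have "\<dots> = ?x ^ (t1 - e1) * (\<Sum>f\<in>B. const (c f) * (?x ^ (e1 - d1 f) * ?y ^ (t2 - d2 f) * f))"
    unfolding sum_distrib_left
  proof (rule sum.cong[OF refl])
    fix f assume "f \<in> B"
    then have "t1 - d1 f = (t1 - e1) + (e1 - d1 f)" using e1 e1t by simp
    then show "const (c f) * (?x ^ (t1 - d1 f) * ?y ^ (t2 - d2 f) * f) =
      ?x ^ (t1 - e1) * (const (c f) * (?x ^ (e1 - d1 f) * ?y ^ (t2 - d2 f) * f))"
      by (simp only: power_add ac_simps)
  qed
  finally have "?x ^ (t1 - e1) * (\<Sum>f\<in>B. const (c f) * (?x ^ (e1 - d1 f) * ?y ^ (t2 - d2 f) * f)) \<in> I"
    using rel by (simp add: d1_def d2_def)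
  then have "(\<Sum>f\<in>B. const (c f) * (?x ^ (e1 - d1 f) * ?y ^ (t2 - d2 f) * f)) \<in> I"
    by (rule regular_power[rotated]) (rule xI)
  then have sumB: "(\<Sum>f\<in>B. const (c f) * (?x ^ (e1 - d1 f) * ?y ^ (t2 - d2 f) * f)) \<in> ?Ix"
    using xIx(2) by blast
  \<comment> \<open>Outside \<open>C\<close> a factor x_0 survives the cancellation.\<close>
  have sumBC: "(\<Sum>f\<in>B - C. const (c f) * (?x ^ (e1 - d1 f) * ?y ^ (t2 - d2 f) * f)) \<in> ?Ix"
  proof (rule ideal_sum[OF Ix])
    fix f assume "f \<in> B - C"
    then have "d1 f < e1" using e1[of f] by (auto simp: C_def)
    then have "e1 - d1 f = Suc (e1 - d1 f - 1)" by simp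
    then have "?x ^ (e1 - d1 f) = ?x ^ (e1 - d1 f - 1) * ?x" by (metis power_Suc2)
    then show "const (c f) * (?x ^ (e1 - d1 f) * ?y ^ (t2 - d2 f) * f) \<in> ?Ix"
      using xIx(1) by (simp only:) (intro ideal_mult[OF Ix] ideal_mult_right[OF Ix])
  qed
  \<comment> \<open>This is what the relation leaves modulo x_0 once the common power of y_0 is
    taken out; \<open>f0\<close> occurs in it with no power of y_0.\<close>
  define g where "g = (\<Sum>f\<in>C. const (c f) * (?y ^ (e2 - d2 f) * f))"
  have "(\<Sum>f\<in>C. const (c f) * (?x ^ (e1 - d1 f) * ?y ^ (t2 - d2 f) * f)) = ?y ^ (t2 - e2) * g"
    unfolding g_def sum_distrib_left
  proof (rule sum.cong[OF refl])
    fix f assume f: "f \<in> C"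
    then have "t2 - d2 f = (t2 - e2) + (e2 - d2 f)" using e2 e2t by simp
    moreover have "d1 f = e1" using f by (simp add: C_def)
    ultimately show "const (c f) * (?x ^ (e1 - d1 f) * ?y ^ (t2 - d2 f) * f) =
      ?y ^ (t2 - e2) * (const (c f) * (?y ^ (e2 - d2 f) * f))"
      by (simp only: power_add ac_simps diff_self_eq_0 power_0 mult_1)
  qed
  moreover have "(\<Sum>f\<in>C. const (c f) * (?x ^ (e1 - d1 f) * ?y ^ (t2 - d2 f) * f)) \<in> ?Ix"
    using ideal_diff[OF Ix sumB sumBC] unfolding sum.subset_diff[OF CB finB] by simp
  ultimately have "?y ^ (t2 - e2) * g \<in> ?Ix" by simp
  then have "g \<in> ?Ix" by (rule regular_power[rotated]) (rule y)
  then obtain h where h: "g - ?x * h \<in> I" using gen_insert_iff[of g ?x I] gen_ideal[OF I(1)] by auto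

  have Jid: "ideal J coord_ring" unfolding J by (rule ideal_gen)
  have IJ: "I \<subseteq> J" "S \<subseteq> J" unfolding J using subset_gen[of "I \<union> S"] by auto
  have CS: "C \<subseteq> S" using CB BA A(1) by blast
  have "g \<in> J"
    unfolding g_def using CS IJ(2) by (intro ideal_sum[OF Jid] ideal_mult[OF Jid]) blast
  moreover have "g - ?x * h \<in> J" using h IJ by blast
  ultimately have "g - (g - ?x * h) \<in> J" by (rule ideal_diff[OF Jid])
  \<comment> \<open>Since both \<open>g\<close> and \<open>g - ?x * h\<close> lie in
    \<open>J\<close>, so does \<open>?x * h\<close>, and x_0 is regular modulo
    \<open>J\<close>.\<close>
  then have "h \<in> J" using xJ[of h] by simp

  let ?K = "gen (I \<union> (S - {f0}))"
  have K: "ideal ?K coord_ring" by (rule ideal_gen)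
  have IK: "I \<subseteq> ?K" "S - {f0} \<subseteq> ?K" using subset_gen[of "I \<union> (S - {f0})"] by auto
  have f0S: "f0 \<in> S" using f0 CS by blast
  then have "insert f0 (I \<union> (S - {f0})) = I \<union> S" by blast
  \<comment> \<open>Modulo the other generators \<open>h\<close> is a multiple of \<open>f0\<close>,
    so the relation becomes a multiple of \<open>f0\<close> alone.\<close>
  with \<open>h \<in> J\<close> obtain r where "h - f0 * r \<in> ?K"
    unfolding J using gen_insert_iff[of h f0 "I \<union> (S - {f0})"] by auto
  then have xh: "?x * (h - f0 * r) \<in> ?K" by (rule ideal_mult[OF K])
  have gh: "g - ?x * h \<in> ?K" using h IK by blast
  have rest: "(\<Sum>f\<in>C - {f0}. const (c f) * (?y ^ (e2 - d2 f) * f)) \<in> ?K"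
    using CS IK(2) by (intro ideal_sum[OF K] ideal_mult[OF K]) blast
  have "(g - ?x * h) + ?x * (h - f0 * r) - (\<Sum>f\<in>C - {f0}. const (c f) * (?y ^ (e2 - d2 f) * f)) \<in> ?K"
    by (rule ideal_diff[OF K ideal_add[OF K gh xh] rest])
  moreover have "g = const (c f0) * f0 + (\<Sum>f\<in>C - {f0}. const (c f) * (?y ^ (e2 - d2 f) * f))"
    unfolding g_def using f0 by (subst sum.remove[OF finC f0(1)]) simp
  ultimately have mem: "f0 * (const (c f0) - ?x * r) \<in> ?K" by (simp add: algebra_simps)

  have "c f0 \<noteq> 0" using f0(1) CB by (auto simp: B_def)
  have "f0 \<noteq> 0" using minimal[OF f0S] ideal_0[OF K] by auto
  then have "bihomogeneous (bidegree f0) f0" using S(2)[OF f0S] by (intro bihomogeneous_bidegree)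
  then have hom: "bihomogeneous (d1 f0, d2 f0) f0" by (simp add: d1_def d2_def)
  have "bigraded ?K" using I(2) S(2) by (intro bigraded_gen_Un) auto
  \<comment> \<open>In the bidegree of \<open>f0\<close> the term with x_0 disappears, since
    \<open>?x * r\<close> has no component of bidegree \<open>(0, 0)\<close>; a nonzero scalar
    multiple of \<open>f0\<close> remains.\<close>
  then have "bicomp (d1 f0, d2 f0) (f0 * (const (c f0) - ?x * r)) \<in> ?K"
    using mem unfolding bigraded_def by blast
  then have "f0 * const (c f0) \<in> ?K"
    by (simp add: bicomp_mult[OF hom] bicomp_diff bicomp_mult[OF bihomogeneous_var_x]
        bicomp_bihomogeneous[OF bihomogeneous_const])
  then have "const (1 / c f0) * (f0 * const (c f0)) \<in> ?K" by (rule ideal_mult[OF K])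
  moreover have "const (1 / c f0) * (f0 * const (c f0)) = f0 * const (1 / c f0 * c f0)"
    by (simp only: const_mult ac_simps)
  ultimately show False using minimal[OF f0S] \<open>c f0 \<noteq> 0\<close> by simp
qed

section \<open>Linear independence of residue classes\<close>

lemma Span_residue_class:
  assumes "distinct fs"
    and "r \<in> ring.Span (fat_ring Z) (residue_class Z ` range const) (map (\<lambda>f. residue_class Z (g f)) fs)"
  shows "\<exists>c. r = residue_class Z (\<Sum>f\<in>set fs. const (c f) * g f)"
  using assms
proof (induction fs arbitrary: r)
  case Nil
  then show ?case by (simp add: ring.Span.simps[OF ring_fat_ring] residue_class_zero)
next
  case (Cons f fs)
  then obtain k s where "r = residue_class Z (const k) \<otimes>\<^bsub>fat_ring Z\<^esub> residue_class Z (g f) \<oplus>\<^bsub>fat_ring Z\<^esub> s"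
    and "s \<in> ring.Span (fat_ring Z) (residue_class Z ` range const) (map (\<lambda>f. residue_class Z (g f)) fs)"
    by (auto simp: ring.Span.simps[OF ring_fat_ring] ring.line_extension_mem_iff[OF ring_fat_ring])
  moreover from Cons.IH[OF _ this(2)] Cons.prems(1)
  obtain c where "s = residue_class Z (\<Sum>f\<in>set fs. const (c f) * g f)" by auto
  \<comment> \<open>Distinctness lets \<open>f\<close> receive the coefficient \<open>k\<close>
    without disturbing the sum over \<open>fs\<close>.\<close>
  moreover have "(\<Sum>h\<in>set fs. const ((c(f := k)) h) * g h) = (\<Sum>f\<in>set fs. const (c f) * g f)"
    using Cons.prems(1) by (intro sum.cong) auto
  ultimately have "r = residue_class Z (\<Sum>h\<in>set (f # fs). const ((c(f := k)) h) * g h)"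
    using Cons.prems(1) by (simp add: residue_class_add residue_class_mult)
  then show ?case by blast
qed

text \<open>Independence of a list is recursive: the head lies outside the span of the tail, and the
  tail is independent. Distinctness allows coefficients indexed by the elements themselves.\<close>

lemma independent_residue_class:
  assumes "distinct fs"
    and "\<And>c. (\<Sum>f\<in>set fs. const (c f) * g f) \<in> fat_ideal Z \<Longrightarrow> \<forall>f\<in>set fs. c f = 0"
  shows "ring.independent (fat_ring Z) (residue_class Z ` range const)
    (map (\<lambda>f. residue_class Z (g f)) fs)"
  using assms
proof (induction fs)
  case Nil
  show ?case by (simp add: ring.li_Nil[OF ring_fat_ring])
next
  case (Cons f fs)
  have sum_upd: "(\<Sum>h\<in>set (f # fs). const ((c(f := k)) h) * g h) =
      const k * g f + (\<Sum>h\<in>set fs. const (c h) * g h)" for c k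
  proof -
    have "(\<Sum>h\<in>set fs. const ((c(f := k)) h) * g h) = (\<Sum>f\<in>set fs. const (c f) * g f)"
      using Cons.prems(1) by (intro sum.cong) auto
    then show ?thesis using Cons.prems(1) by simp
  qed
  have "residue_class Z (g f) \<in> carrier (fat_ring Z)" by (simp add: carrier_fat_ring)
  moreover have "residue_class Z (g f) \<notin>
    ring.Span (fat_ring Z) (residue_class Z ` range const) (map (\<lambda>f. residue_class Z (g f)) fs)"
  proof
    assume "residue_class Z (g f) \<in>
      ring.Span (fat_ring Z) (residue_class Z ` range const) (map (\<lambda>f. residue_class Z (g f)) fs)"
    then obtain c where "residue_class Z (g f) = residue_class Z (\<Sum>f\<in>set fs. const (c f) * g f)"
      using Span_residue_class[of fs "residue_class Z (g f)" Z g] Cons.prems(1) by auto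
    then have "(\<Sum>f\<in>set fs. const (c f) * g f) - g f \<in> fat_ideal Z"
      unfolding residue_class_eq_iff[symmetric] by (rule sym)
    \<comment> \<open>The head enters the relation with coefficient \<open>- 1\<close>, which is
      nonzero.\<close>
    then have "(\<Sum>h\<in>set (f # fs). const ((c(f := - 1)) h) * g h) \<in> fat_ideal Z"
      unfolding sum_upd by (simp add: const_uminus)
    from Cons.prems(2)[OF this] show False by simp
  qed
  moreover have "ring.independent (fat_ring Z) (residue_class Z ` range const)
    (map (\<lambda>f. residue_class Z (g f)) fs)"
  proof (rule Cons.IH)
    show "distinct fs" using Cons.prems(1) by simp
    fix c assume "(\<Sum>f\<in>set fs. const (c f) * g f) \<in> fat_ideal Z"
    then have "(\<Sum>h\<in>set (f # fs). const ((c(f := 0)) h) * g h) \<in> fat_ideal Z"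
      unfolding sum_upd by simp
    from Cons.prems(2)[OF this] show "\<forall>f\<in>set fs. c f = 0"
      using Cons.prems(1) by (auto split: if_splits)
  qed
  ultimately show ?case by (simp add: ring.li_Cons[OF ring_fat_ring])
qed

section \<open>Minimal separators as generators modulo the fat ideal\<close>

lemma minimal_separators_distinct:
  assumes "minimal_separators Z P F"
  shows "distinct F"
proof (rule ccontr)
  assume "\<not> distinct F"
  then have "card (set F) < length F" using card_distinct card_length le_neq_implies_less by blast
  then show False using assms unfolding minimal_separators_def by blast
qed

text \<open>A redundant \<open>f\<close> could be removed, leaving fewer generators than the minimal
  number.\<close>

lemma minimal_separators_irredundant:
  assumes F: "minimal_separators Z P F" and f: "f \<in> set F"
  shows "f \<notin> gen (fat_ideal Z \<union> (set F - {f}))"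
proof
  let ?K = "gen (fat_ideal Z \<union> (set F - {f}))"
  assume "f \<in> ?K"
  then have "fat_ideal Z \<union> set F \<subseteq> ?K" using subset_gen[of "fat_ideal Z \<union> (set F - {f})"] by blast
  then have "gen (fat_ideal Z \<union> set F) \<subseteq> ?K" by (rule gen_minimal[OF ideal_gen])
  moreover have "?K \<subseteq> gen (fat_ideal Z \<union> set F)" by (rule gen_mono) blast
  ultimately have "genideal (fat_ring Z) (residue_class Z ` set F) =
    genideal (fat_ring Z) (residue_class Z ` (set F - {f}))"
    unfolding genideal_fat_ring_eq by simp
  moreover have "card (set F - {f}) < length F"
    using card_Diff1_less[OF _ f] card_length[of F] by simp
  ultimately show False using F unfolding minimal_separators_def by (metis finite_Diff List.finite_set)
qed

text \<open>Both ideals contain the fat ideal of \<open>Z\<close>, so each is determined by its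
  image in the residue ring.\<close>

lemma minimal_separators_generate:
  assumes "minimal_separators Z P F"
  shows "fat_ideal (reduce_at Z P) = gen (fat_ideal Z \<union> set F)"
proof -
  let ?J = "fat_ideal (reduce_at Z P)" and ?G = "gen (fat_ideal Z \<union> set F)"
  have IJ: "fat_ideal Z \<subseteq> ?J" by (rule fat_ideal_antimono) (simp add: reduce_at_def)
  have IG: "fat_ideal Z \<subseteq> ?G" using subset_gen[of "fat_ideal Z \<union> set F"] by blast
  have mem: "f \<in> K" if K: "ideal K coord_ring" "fat_ideal Z \<subseteq> K"
    and f: "residue_class Z f \<in> residue_class Z ` K" for f K
  proof -
    obtain g where g: "g \<in> K" "f - g \<in> fat_ideal Z" using f by (auto simp: residue_class_eq_iff)
    then have "f - g + g \<in> K" using K(2) by (intro ideal_add[OF K(1)]) blast+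
    then show ?thesis by simp
  qed
  have eq: "residue_class Z ` ?J = residue_class Z ` ?G"
    using assms by (simp add: minimal_separators_def genideal_fat_ring_eq)
  show ?thesis
  proof (intro subset_antisym subsetI)
    show "f \<in> ?G" if "f \<in> ?J" for f
      using mem[OF ideal_gen IG, of f] imageI[OF that, of "residue_class Z"] eq by simp
    show "f \<in> ?J" if "f \<in> ?G" for f
      using mem[OF ideal_fat_ideal IJ, of f] imageI[OF that, of "residue_class Z"] eq by simp
  qed
qed

theorem theorem5p1:
  fixes Z :: "('k::{alg_closed_field, field_char_0}, 'n::finite, 'm::finite) bipoint \<Rightarrow> nat"
    and P :: "('k, 'n, 'm) bipoint"
    and F :: "('k, 'n, 'm) bipoly list"
  assumes "fat_points Z"
    and "\<forall>Q\<in>supp Z. \<not> vanishes_at (var_x None) Q \<and> \<not> vanishes_at (var_y None) Q"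
    and "ACM Z"
    and "P \<in> supp Z"
    and "minimal_separators Z P F"
  shows "good_minimal_separators Z P F"
  unfolding good_minimal_separators_def
proof (intro conjI allI)
  show "minimal_separators Z P F" by fact
next
  fix t1 t2
  let ?Z' = "reduce_at Z P"
  let ?good = "\<lambda>f :: ('k, 'n, 'm) bipoly. fst (bidegree f) \<le> t1 \<and> snd (bidegree f) \<le> t2"
  let ?g = "\<lambda>f. var_x None ^ (t1 - fst (bidegree f)) * var_y None ^ (t2 - snd (bidegree f)) * f"
  have fin: "finite (supp Z)" using assms(1) by (simp add: fat_points_def)
  have off: "off_axes Q" if "Q \<in> supp Z" for Q
    using assms(1,2) that by (auto simp: off_axes_def fat_points_def)
  have off': "off_axes Q" if "Q \<in> supp ?Z'" for Q
    using that by (intro off) (auto simp: supp_def reduce_at_def split: if_splits)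
  \<comment> \<open>Stated for any such \<open>Y\<close> because it serves both \<open>Z\<close> and
    \<open>?Z'\<close>.\<close>
  have x: "var_x None * f \<in> fat_ideal Y \<Longrightarrow> f \<in> fat_ideal Y"
    if "\<And>Q. Q \<in> supp Y \<Longrightarrow> off_axes Q" for f and Y :: "('k, 'n, 'm) bipoint \<Rightarrow> nat"
    using fat_ideal_regular[OF that, of Y "Inl None" f] by (simp add: affine_vars_def var_x_eq)
  have "\<forall>f\<in>set (filter ?good F). c f = 0"
    if "(\<Sum>f\<in>set (filter ?good F). const (c f) * ?g f) \<in> fat_ideal Z" for c
  proof (rule minimal_generators_relation_trivial[OF ideal_fat_ideal bigraded_fat_ideal
        minimal_separators_generate[OF assms(5)] _ _ _ _ _ _ _ _ that])
    show "biform f" if "f \<in> set F" for f using assms(5) that by (simp add: minimal_separators_def)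
    show "f \<notin> gen (fat_ideal Z \<union> (set F - {f}))" if "f \<in> set F" for f
      using assms(5) that by (rule minimal_separators_irredundant)
    show "f \<in> fat_ideal Z" if "var_x None * f \<in> fat_ideal Z" for f using x[OF off that] .
    show "f \<in> fat_ideal ?Z'" if "var_x None * f \<in> fat_ideal ?Z'" for f using x[OF off' that] .
    show "f \<in> gen (insert (var_x None) (fat_ideal Z))"
      if "var_y None * f \<in> gen (insert (var_x None) (fat_ideal Z))" for f
      using ACM_regular[OF fin off assms(3) that] .
  qed auto
  then have "ring.independent (fat_ring Z) (residue_class Z ` range const)
    (map (\<lambda>f. residue_class Z (?g f)) (filter ?good F))"
    using minimal_separators_distinct[OF assms(5)] by (intro independent_residue_class) auto
  \<comment> \<open>The list comprehension in the goal unfolds to this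
    \<open>concat\<close>.\<close>
  moreover have "concat (map (\<lambda>f. if ?good f then [residue_class Z (?g f)] else []) F) =
    map (\<lambda>f. residue_class Z (?g f)) (filter ?good F)"
    by (induction F) auto
  ultimately show "ring.independent (fat_ring Z) (residue_class Z ` range const)
    [residue_class Z (?g f). f \<leftarrow> F, ?good f]"
    by simp
qed

end
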